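(* Let $\Gamma$ be a group and let $\Lambda\leq\Gamma$ be a commensurated subgroup. Then the action $\Lambda\curvearrowright\partial_F\Lambda$ of $\Lambda$ on its Furstenberg boundary extends in a unique way to an action of $\Gamma$ on $\partial_F\Lambda$ (by homeomorphisms).
   Context: Groups are discrete. A subgroup $\Lambda\leq\Gamma$ is commensurated if $[\Lambda:\Lambda\cap g\Lambda g^{-1}]<\infty$ for every $g\in\Gamma$. For an action of a group $G$ by homeomorphisms on a compact Hausdorff space $X$: the action is minimal if $X$ contains no non-trivial (non-empty proper) closed invariant subset; it is proximal if for all $x,y\in X$ there is a net $(g_i)\subset G$ such that $(g_ix)$ and $(g_iy)$ converge and $\lim g_ix=\lim g_iy$; it is strongly proximal if the induced action of $G$ on the space $\mathrm{Prob}(X)$ of regular probability measures on $X$ (weak* topology) is proximal. $X$ is a $G$-boundary if the action is minimal and strongly proximal. The Furstenberg boundary $\partial_FG$ is the universal $G$-boundary, i.e. the (unique up to $G$-equivariant homeomorphism) $G$-boundary such that every $G$-boundary is a continuous $G$-equivariant image of it. *)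

theory Defs
  imports "HOL-Algebra.Group_Action" "HOL-Probability.Probability"
begin

definition commensurated :: "('g, 'b) monoid_scheme \<Rightarrow> 'g set \<Rightarrow> bool" where
  "commensurated G L \<longleftrightarrow> (\<forall>g\<in>carrier G.
     finite (rcosets\<^bsub>G\<lparr>carrier := L\<rparr>\<^esub> (L \<inter> (g <#\<^bsub>G\<^esub> L #>\<^bsub>G\<^esub> inv\<^bsub>G\<^esub> g))))"

definition homeo_action ::
    "('g, 'b) monoid_scheme \<Rightarrow> 'x topology \<Rightarrow> ('g \<Rightarrow> 'x \<Rightarrow> 'x) \<Rightarrow> bool" where
  "homeo_action G X \<phi> \<longleftrightarrow>
     group_action G (topspace X) \<phi> \<and> (\<forall>g\<in>carrier G. homeomorphic_map X X (\<phi> g))"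

definition minimal_action ::
    "('g, 'b) monoid_scheme \<Rightarrow> 'x topology \<Rightarrow> ('g \<Rightarrow> 'x \<Rightarrow> 'x) \<Rightarrow> bool" where
  "minimal_action G X \<phi> \<longleftrightarrow>
     (\<forall>S. closedin X S \<longrightarrow> (\<forall>g\<in>carrier G. \<phi> g ` S \<subseteq> S) \<longrightarrow> S = {} \<or> S = topspace X)"

text \<open>
  Nets in the group are represented by the filters they generate: a proper filter that contains
  the carrier of the group.
\<close>

definition proximal_action ::
    "('g, 'b) monoid_scheme \<Rightarrow> 'x topology \<Rightarrow> ('g \<Rightarrow> 'x \<Rightarrow> 'x) \<Rightarrow> bool" where
  "proximal_action G X \<phi> \<longleftrightarrow>
     (\<forall>x\<in>topspace X. \<forall>y\<in>topspace X. \<exists>F z.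
        F \<noteq> bot \<and> (\<forall>\<^sub>F g in F. g \<in> carrier G) \<and>
        limitin X (\<lambda>g. \<phi> g x) z F \<and> limitin X (\<lambda>g. \<phi> g y) z F)"

definition borel_measure_of :: "'x topology \<Rightarrow> 'x measure" where
  "borel_measure_of X = sigma (topspace X) {U. openin X U}"

definition regular_probs :: "'x topology \<Rightarrow> 'x measure set" where
  "regular_probs X = {\<mu>. prob_space \<mu> \<and>
     space \<mu> = topspace X \<and> sets \<mu> = sets (borel_measure_of X) \<and>
     (\<forall>A\<in>sets \<mu>. emeasure \<mu> A = (SUP K\<in>{K. compactin X K \<and> K \<subseteq> A}. emeasure \<mu> K)) \<and>
     (\<forall>A\<in>sets \<mu>. emeasure \<mu> A = (INF U\<in>{U. openin X U \<and> A \<subseteq> U}. emeasure \<mu> U))}"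

text \<open>
  The weak* topology: the coarsest topology for which integration against each continuous
  real-valued function is continuous.
\<close>

definition Prob_topology :: "'x topology \<Rightarrow> 'x measure topology" where
  "Prob_topology X = pullback_topology (regular_probs X)
     (\<lambda>\<mu>. \<lambda>f\<in>{f. continuous_map X euclideanreal f}. \<integral>x. f x \<partial>\<mu>)
     (product_topology (\<lambda>_. euclideanreal) {f. continuous_map X euclideanreal f})"

definition strongly_proximal_action ::
    "('g, 'b) monoid_scheme \<Rightarrow> 'x topology \<Rightarrow> ('g \<Rightarrow> 'x \<Rightarrow> 'x) \<Rightarrow> bool" where
  "strongly_proximal_action G X \<phi> \<longleftrightarrow>
     proximal_action G (Prob_topology X) (\<lambda>g \<mu>. distr \<mu> (borel_measure_of X) (\<phi> g))"

text \<open>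
  Boundaries are non-empty: the empty space is vacuously minimal and strongly proximal, but it
  is not an image of any non-empty space, so admitting it would rule out a universal boundary.
\<close>

definition boundary_action ::
    "('g, 'b) monoid_scheme \<Rightarrow> 'x topology \<Rightarrow> ('g \<Rightarrow> 'x \<Rightarrow> 'x) \<Rightarrow> bool" where
  "boundary_action G X \<phi> \<longleftrightarrow>
     compact_space X \<and> Hausdorff_space X \<and> topspace X \<noteq> {} \<and> homeo_action G X \<phi> \<and>
     minimal_action G X \<phi> \<and> strongly_proximal_action G X \<phi>"

text \<open>
  A definition in HOL cannot quantify over all types. In a boundary every orbit is dense, so a
  point is determined by the traces of its neighbourhoods on one orbit. Hence the points of any
  boundary of a group on the type \<open>'g\<close> embed into \<open>'g set set\<close>, and every boundary has an
  isomorphic copy with points in this type.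
\<close>

lemma boundary_action_embeds:
  fixes G :: "('g, 'b) monoid_scheme" and Y :: "'y topology"
  assumes "boundary_action G Y \<psi>"
  shows "\<exists>e :: 'y \<Rightarrow> 'g set set. inj_on e (topspace Y)"
proof -
  have H: "Hausdorff_space Y" and ne: "topspace Y \<noteq> {}" and m: "minimal_action G Y \<psi>"
    and act: "group_action G (topspace Y) \<psi>"
    and hom: "\<And>g. g \<in> carrier G \<Longrightarrow> homeomorphic_map Y Y (\<psi> g)"
    using assms by (auto simp: boundary_action_def homeo_action_def)
  interpret group_action G "topspace Y" \<psi> by (fact act)
  interpret group G using group_hom group_hom.axioms(1) by blast
  obtain p where p: "p \<in> topspace Y" using ne by blast
  define R where "R = (\<lambda>g. \<psi> g p) ` carrier G"
  have RY: "R \<subseteq> topspace Y"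
    unfolding R_def using p element_image by blast
  have inv: "\<psi> g ` R \<subseteq> R" if "g \<in> carrier G" for g
  proof
    fix y assume "y \<in> \<psi> g ` R"
    then obtain h where h: "h \<in> carrier G" "y = \<psi> g (\<psi> h p)" by (auto simp: R_def)
    then have "y = \<psi> (g \<otimes>\<^bsub>G\<^esub> h) p"
      using composition_rule[OF p that h(1)] by simp
    with that h(1) show "y \<in> R" by (auto simp: R_def)
  qed
  define C where "C = Abstract_Topology.closure_of Y R"
  have "\<psi> g ` C \<subseteq> C" if g: "g \<in> carrier G" for g
  proof -
    have "\<psi> g ` C \<subseteq> Abstract_Topology.closure_of Y (\<psi> g ` R)"
      unfolding C_def
      by (rule continuous_map_image_closure_subset[OF homeomorphic_imp_continuous_map[OF hom[OF g]]])
    also have "\<dots> \<subseteq> C"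
      unfolding C_def by (rule closure_of_mono[OF inv[OF g]])
    finally show ?thesis .
  qed
  then have "C = {} \<or> C = topspace Y"
    using m closedin_closure_of[of Y R] unfolding minimal_action_def C_def by metis
  moreover have "R \<subseteq> C" "R \<noteq> {}"
    using closure_of_subset[OF RY] one_closed by (auto simp: R_def C_def)
  ultimately have dense: "C = topspace Y" by blast
  have hit: "\<exists>g\<in>carrier G. \<psi> g p \<in> U" if "openin Y U" "U \<noteq> {}" for U
  proof -
    have "U \<inter> C \<noteq> {}" using that openin_subset[OF that(1)] dense by blast
    then have "U \<inter> R \<noteq> {}"
      using openin_Int_closure_of_eq_empty[OF that(1), of R] by (simp add: C_def)
    then show ?thesis by (auto simp: R_def)
  qed
  define t where "t U = {g \<in> carrier G. \<psi> g p \<in> U}" for U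
  define e where "e y = {t U |U. openin Y U \<and> y \<in> U}" for y
  have "inj_on e (topspace Y)"
  proof (rule inj_onI, rule ccontr)
    fix y z assume yz: "y \<in> topspace Y" "z \<in> topspace Y" "e y = e z" "y \<noteq> z"
    then obtain U V where UV: "openin Y U" "openin Y V" "y \<in> U" "z \<in> V" "disjnt U V"
      using H by (metis Hausdorff_space_def)
    then have "t U \<in> e z" using yz(3) unfolding e_def by blast
    then obtain W where W: "openin Y W" "z \<in> W" "t U = t W" by (auto simp: e_def)
    then obtain g where "g \<in> carrier G" "\<psi> g p \<in> V \<inter> W"
      using hit[of "V \<inter> W"] UV openin_Int by blast
    with W(3) UV(5) show False by (auto simp: t_def disjnt_iff)
  qed
  then show ?thesis by blast
qed

definition furstenberg_boundary ::
    "('g, 'b) monoid_scheme \<Rightarrow> 'x topology \<Rightarrow> ('g \<Rightarrow> 'x \<Rightarrow> 'x) \<Rightarrow> bool" where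
  "furstenberg_boundary G X \<phi> \<longleftrightarrow> boundary_action G X \<phi> \<and>
     (\<forall>(Y :: 'g set set topology) \<psi>. boundary_action G Y \<psi> \<longrightarrow>
        (\<exists>f. continuous_map X Y f \<and> f ` topspace X = topspace Y \<and>
             (\<forall>g\<in>carrier G. \<forall>x\<in>topspace X. f (\<phi> g x) = \<psi> g (f x))))"

end

theory Submission
  imports Defs
begin

text \<open>
  A boundary action is characterized by a uniform contraction property: for every non-empty open
  \<open>U\<close> and \<open>e > 0\<close> finitely many group elements suffice to push every finitely additive probability
  on all subsets of the space into \<open>U\<close> up to mass \<open>e\<close>. In this form strong proximality passes
  to finite index subgroups and to minimal subsets of products by elementary estimates.

  Let \<open>\<Lambda>\<close> act on the functions \<open>f : \<Gamma> \<rightarrow> \<partial>\<^sub>F\<Lambda>\<close> with \<open>f (l g) = l f g\<close> for \<open>l \<in> \<Lambda>\<close>, by right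
  translation. On finitely many coordinates \<open>g\<close> a finite index subgroup of \<open>\<Lambda>\<close> acts through the
  conjugations \<open>n \<mapsto> g n g\<^sup>-\<^sup>1\<close>, by commensuration. So a minimal
  closed invariant set of such functions is a \<open>\<Lambda>\<close>-boundary, and universality provides an equivariant map \<open>x \<mapsto> (g \<mapsto> \<psi> g x)\<close> from \<open>\<partial>\<^sub>F\<Lambda>\<close> into
  it. Two maps that are equivariant with respect to a finite index subgroup and the same
  conjugation coincide; this makes \<open>\<psi>\<close> an action of \<open>\<Gamma>\<close> extending the given one, and the only one.
\<close>

section \<open>Finitely additive probabilities\<close>

text \<open>Charges on all subsets replace measures for two reasons. They push forward along
  arbitrary maps, such as coordinate evaluations on a possibly uncountable product, whose Borel sets
  need not be generated by boxes. And evaluation at any set is continuous on the compact space of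
  charges, so a failure of contraction for all finite sets of group elements is witnessed by a
  single charge. That the finite set does not depend on the charge is what lets arguments be
  chained: the next target is shrunk to suit finitely many elements.

  The obstacle is that \<open>g \<otimes> n \<otimes> inv g\<close> need not lie in \<Lambda>. The
  subgroup \<open>core S\<close> of elements with all conjugates by \<open>S\<close> in \<Lambda>
  depends on the finite set \<open>S\<close>, and no single one need serve all coordinates. On
  several coordinates the action need not have dense orbits, so a charge can be concentrated in some
  small box but not in a prescribed one; minimality of the chosen subset supplies the aim
  afterwards.\<close>

definition charge :: "'x set \<Rightarrow> ('x set \<Rightarrow> real) \<Rightarrow> bool" where
  "charge S m \<longleftrightarrow> (\<forall>A. 0 \<le> m A) \<and> m UNIV = 1 \<and> m S = 1 \<and>
     (\<forall>A B. A \<inter> B = {} \<longrightarrow> m (A \<union> B) = m A + m B)"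

lemma charge_nonneg: "charge S m \<Longrightarrow> 0 \<le> m A"
  by (simp add: charge_def)

lemma charge_Un: "charge S m \<Longrightarrow> A \<inter> B = {} \<Longrightarrow> m (A \<union> B) = m A + m B"
  by (simp add: charge_def)

lemma charge_empty: "charge S m \<Longrightarrow> m {} = 0"
  using charge_Un[of S m "{}" "{}"] by simp

lemma charge_mono: "charge S m \<Longrightarrow> A \<subseteq> B \<Longrightarrow> m A \<le> m B"
  using charge_Un[of S m A "B - A"] charge_nonneg[of S m "B - A"]
  by (simp add: Un_absorb1)

text \<open>Total mass 1 on both \<open>UNIV\<close> and \<open>S\<close> makes the complement of
  \<open>S\<close> null, so inclusions have to be checked on \<open>S\<close> only.\<close>

lemma charge_mono_on:
  assumes "charge S m" "A \<inter> S \<subseteq> B"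
  shows "m A \<le> m B"
proof -
  have "m (- S) = 0"
    using assms(1) charge_Un[of S m S "- S"] by (simp add: charge_def)
  have "m A \<le> m (B \<union> - S)"
    using assms(2) by (intro charge_mono[OF assms(1)]) blast
  also have "\<dots> \<le> m B + m (- S - B)"
    using charge_Un[OF assms(1), of B "- S - B"] by (simp add: Un_Diff_cancel)
  also have "m (- S - B) \<le> m (- S)"
    by (intro charge_mono[OF assms(1)]) blast
  finally show ?thesis using \<open>m (- S) = 0\<close> by simp
qed

lemma charge_le_1: "charge S m \<Longrightarrow> m A \<le> 1"
  using charge_mono[of S m A UNIV] by (simp add: charge_def)

lemma charge_Compl: "charge S m \<Longrightarrow> m (- A) = 1 - m A"
  using charge_Un[of S m A "- A"] by (simp add: charge_def)

lemma charge_Un_le: "charge S m \<Longrightarrow> m (A \<union> B) \<le> m A + m B"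
  using charge_Un[of S m A "B - A"] charge_mono[of S m "B - A" B] by simp

lemma charge_Int_ge: "charge S m \<Longrightarrow> m A + m B - 1 \<le> m (A \<inter> B)"
  using charge_Un_le[of S m "- A" "- B"] charge_Compl[of S m A] charge_Compl[of S m B]
    charge_Compl[of S m "A \<inter> B"]
  by (simp add: Compl_Int)

lemma charge_vimage:
  assumes "charge S m" "f \<in> S \<rightarrow> T"
  shows "charge T (\<lambda>A. m (f -` A))"
proof -
  have "m S \<le> m (f -` T)"
    using assms by (intro charge_mono[of S]) auto
  then have "m (f -` T) = 1"
    using assms charge_le_1[of S m "f -` T"] by (simp add: charge_def)
  moreover have "m (f -` A \<union> f -` B) = m (f -` A) + m (f -` B)" if "A \<inter> B = {}" for A B
    using that by (intro charge_Un[OF assms(1)]) auto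
  ultimately show ?thesis
    using assms(1) by (auto simp: charge_def vimage_Un)
qed

lemma charge_dirac: "x \<in> S \<Longrightarrow> charge S (\<lambda>A. of_bool (x \<in> A))"
  by (auto simp: charge_def)

lemma charge_average:
  "charge S m \<Longrightarrow> charge S n \<Longrightarrow> charge S (\<lambda>A. (m A + n A) / 2)"
  by (simp add: charge_def add_divide_distrib)

text \<open>The inner content \<open>lam\<close> of \<open>m\<close>, taken over closed subsets of
  open sets, extends to the outer measure \<open>out\<close>, and Caratheodory's construction yields
  a Borel measure. In this passage an open set may lose mass to its boundary but never gains any, so
  the comparison goes one way.\<close>

theorem charge_regularization:
  assumes cp: "compact_space X" and H: "Hausdorff_space X" and m: "charge (topspace X) m"
  shows "\<exists>\<mu>\<in>regular_probs X. \<forall>U. openin X U \<longrightarrow> measure \<mu> U \<le> m U"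
proof -
  define lam where "lam V = (SUP K\<in>{K. closedin X K \<and> K \<subseteq> V}. ennreal (m K))" for V
  define out where "out A = (INF V\<in>{V. openin X V \<and> A \<subseteq> V}. lam V)" for A
  have nrm: "normal_space X"
    using cp H by (simp add: compact_Hausdorff_or_regular_imp_normal_space)
  have lam_ge: "ennreal (m K) \<le> lam V" if "closedin X K" "K \<subseteq> V" for K V
    unfolding lam_def using that by (intro SUP_upper) auto
  have lam_mono: "lam V \<le> lam W" if "V \<subseteq> W" for V W
    unfolding lam_def using that by (intro SUP_subset_mono) auto
  have lam_le: "lam V \<le> ennreal (m V)" for V
    unfolding lam_def by (intro SUP_least) (auto intro!: ennreal_leI charge_mono[OF m])
  have lam_approx: "\<exists>K. closedin X K \<and> K \<subseteq> V \<and> lam V \<le> ennreal (m K) + ennreal e" if "0 < e" for V e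
  proof -
    have ne: "{K. closedin X K \<and> K \<subseteq> V} \<noteq> {}" using closedin_empty by blast
    have fin: "lam V \<noteq> \<infinity>"
      using lam_le[of V] by (auto simp: top_unique)
    from SUP_approx_ennreal[OF that ne lam_def[of V] fin]
    show ?thesis by (auto intro: less_imp_le)
  qed
  \<comment> \<open>Normality gives an open \<open>G\<close> around \<open>K - W\<close> with
    closure inside \<open>V\<close>. It cuts \<open>K\<close> into two closed pieces, one in
    \<open>V\<close> and one in \<open>W\<close>.\<close>
  have lam_Un: "lam (V \<union> W) \<le> lam V + lam W" if VW: "openin X V" "openin X W" for V W
    unfolding lam_def[of "V \<union> W"]
  proof (intro SUP_least, clarify)
    fix K assume K: "closedin X K" "K \<subseteq> V \<union> W"
    obtain G where G: "openin X G" "K - W \<subseteq> G" "Abstract_Topology.closure_of X G \<subseteq> V"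
      using nrm[unfolded normal_space_alt, rule_format, of "K - W" V] K VW(1) closedin_diff[OF K(1) VW(2)] by auto
    have GX: "G \<subseteq> Abstract_Topology.closure_of X G"
      using G(1) by (simp add: closure_of_subset openin_subset)
    have "m K \<le> m (K \<inter> Abstract_Topology.closure_of X G) + m (K - G)"
      using GX by (intro order_trans[OF charge_mono[OF m] charge_Un_le[OF m]]) auto
    then have "ennreal (m K) \<le> ennreal (m (K \<inter> Abstract_Topology.closure_of X G)) + ennreal (m (K - G))"
      using charge_nonneg[OF m] by (simp flip: ennreal_plus)
    also have "\<dots> \<le> lam V + lam W"
      using K G that by (intro add_mono lam_ge) auto
    finally show "ennreal (m K) \<le> lam V + lam W" .
  qed
  have lam_UN_fin: "lam (\<Union>i\<in>I. V i) \<le> (\<Sum>i\<in>I. lam (V i))"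
    if "finite I" "\<And>i. openin X (V i)" for I :: "nat set" and V
    using that(1)
  proof (induction I)
    case empty
    then show ?case using lam_le[of "{}"] by (simp add: charge_empty[OF m])
  next
    case (insert i I)
    have "lam (V i \<union> (\<Union>i\<in>I. V i)) \<le> lam (V i) + lam (\<Union>i\<in>I. V i)"
      using that(2) by (intro lam_Un) auto
    with insert show ?case by (simp add: add_mono order_trans[OF _ add_left_mono])
  qed
  \<comment> \<open>Compactness of \<open>K\<close> reduces countable subadditivity to the finite
    case.\<close>
  have lam_UN: "lam (\<Union>i. V i) \<le> (\<Sum>i. lam (V i))" if VO: "\<And>i::nat. openin X (V i)" for V
    unfolding lam_def[of "\<Union>i. V i"]
  proof (intro SUP_least, clarify)
    fix K assume K: "closedin X K" "K \<subseteq> (\<Union>i. V i)"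
    then have "compactin X K" by (simp add: closedin_compact_space cp)
    then obtain \<F> where "finite \<F>" "\<F> \<subseteq> range V" "K \<subseteq> \<Union>\<F>"
      using compactinD[of X K "range V"] VO K(2) by auto
    then obtain I where I: "finite I" "K \<subseteq> (\<Union>i\<in>I. V i)"
      by (metis finite_subset_image)
    have "ennreal (m K) \<le> lam (\<Union>i\<in>I. V i)" using K I by (intro lam_ge) auto
    also have "\<dots> \<le> (\<Sum>i\<in>I. lam (V i))" using I that by (intro lam_UN_fin) auto
    also have "\<dots> \<le> (\<Sum>i. lam (V i))" using I by (intro sum_le_suminf) auto
    finally show "ennreal (m K) \<le> (\<Sum>i. lam (V i))" .
  qed
  have out_open: "out V = lam V" if "openin X V" for V
    unfolding out_def using that
    by (intro antisym INF_greatest INF_lower) (auto intro: lam_mono)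
  have out_mono: "out A \<le> out B" if "A \<subseteq> B" for A B
    unfolding out_def using that by (intro INF_superset_mono) auto
  have out_le1: "out A \<le> 1" if "A \<subseteq> topspace X" for A
  proof -
    have "out A \<le> lam (topspace X)"
      unfolding out_def using that by (intro INF_lower) auto
    also have "\<dots> \<le> 1"
      using lam_le[of "topspace X"] m by (simp add: charge_def)
    finally show ?thesis .
  qed
  have out_approx: "\<exists>V. openin X V \<and> A \<subseteq> V \<and> lam V \<le> out A + ennreal e"
    if "0 < e" "A \<subseteq> topspace X" for A e
  proof -
    have "out A < out A + ennreal e"
      using ennreal_add_left_cancel_less[of "out A" 0 "ennreal e"] out_le1[OF that(2)] that(1)
      by (auto simp: top_unique)
    then show ?thesis
      by (subst (asm) out_def) (auto simp: INF_less_iff intro: less_imp_le)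
  qed
  let ?\<Omega> = "topspace X"
  have oms: "outer_measure_space (Pow ?\<Omega>) out"
    unfolding outer_measure_space_def
  proof (intro conjI)
    show "positive (Pow ?\<Omega>) out"
      using out_open[of "{}"] lam_le[of "{}"] by (simp add: positive_def charge_empty[OF m])
    show "increasing (Pow ?\<Omega>) out"
      by (simp add: increasing_def out_mono)
    show "countably_subadditive (Pow ?\<Omega>) out"
      unfolding countably_subadditive_def
    proof (intro allI impI, rule ennreal_le_epsilon)
      fix A :: "nat \<Rightarrow> _" and e :: real
      assume A: "range A \<subseteq> Pow ?\<Omega>" and e: "0 < e"
      have "\<forall>n. \<exists>V. openin X V \<and> A n \<subseteq> V \<and> lam V \<le> out (A n) + ennreal (e * (1/2)^Suc n)"
        using A e by (intro allI out_approx) auto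
      then obtain V where V: "\<And>n. openin X (V n)" "\<And>n. A n \<subseteq> V n"
        "\<And>n. lam (V n) \<le> out (A n) + ennreal (e * (1/2)^Suc n)"
        by metis
      have "out (\<Union>i. A i) \<le> lam (\<Union>i. V i)"
        using V out_mono[of "\<Union>i. A i" "\<Union>i. V i"] by (subst out_open[symmetric]) auto
      also have "\<dots> \<le> (\<Sum>i. lam (V i))" using V by (intro lam_UN)
      also have "\<dots> \<le> (\<Sum>n. out (A n) + ennreal (e * (1/2)^Suc n))"
        using V by (intro suminf_le) auto
      also have "\<dots> = (\<Sum>n. out (A n)) + (\<Sum>n. ennreal (e * (1/2)^Suc n))"
        by (rule suminf_add[symmetric]) auto
      also have "(\<Sum>n. ennreal (e * (1/2)^Suc n)) = ennreal e"
        using e power_half_series sums_mult[OF power_half_series, of e]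
        by (intro suminf_ennreal_eq) (auto simp: power_divide)
      finally show "out (\<Union>i. A i) \<le> (\<Sum>n. out (A n)) + ennreal e" .
    qed
  qed
  interpret sigma_algebra ?\<Omega> "Pow ?\<Omega>" by (rule sigma_algebra_Pow)
  let ?L = "lambda_system ?\<Omega> (Pow ?\<Omega>) out"
  have ms: "measure_space ?\<Omega> ?L out" by (rule caratheodory_lemma[OF oms])
  have sub: "out (A \<union> B) \<le> out A + out B" if "A \<subseteq> ?\<Omega>" "B \<subseteq> ?\<Omega>" "A \<inter> B = {}" for A B
    using countably_subadditive_subadditive[of out] oms that
    by (auto simp: outer_measure_space_def subadditive_def)
  have open_L: "V \<in> ?L" if V: "openin X V" for V
    unfolding lambda_system_eq
  proof (intro CollectI conjI ballI antisym)
    show "V \<in> Pow ?\<Omega>" using V by (simp add: openin_subset)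
    fix A assume A: "A \<in> Pow ?\<Omega>"
    have "A = A \<inter> V \<union> (A - V)" by blast
    then show "out A \<le> out (A \<inter> V) + out (A - V)"
      using A sub[of "A \<inter> V" "A - V"] by auto
    show "out (A \<inter> V) + out (A - V) \<le> out A"
    proof (rule ennreal_le_epsilon)
      fix e :: real assume e: "0 < e"
      \<comment> \<open>\<open>K\<close> and \<open>L\<close> will be disjoint closed subsets of
        \<open>W\<close>, so finite additivity of \<open>m\<close> bounds the sum of their masses by
        \<open>lam W\<close>. Each of the three approximations costs \<open>e/3\<close>.\<close>
      obtain W where W: "openin X W" "A \<subseteq> W" "lam W \<le> out A + ennreal (e/3)"
        using out_approx[of "e/3" A] e A by auto
      obtain K where K: "closedin X K" "K \<subseteq> W \<inter> V" "lam (W \<inter> V) \<le> ennreal (m K) + ennreal (e/3)"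
        using lam_approx[of "e/3" "W \<inter> V"] e by auto
      obtain L where L: "closedin X L" "L \<subseteq> W - K" "lam (W - K) \<le> ennreal (m L) + ennreal (e/3)"
        using lam_approx[of "e/3" "W - K"] e by auto
      have "out (A \<inter> V) \<le> lam (W \<inter> V)"
        using V W out_mono[of "A \<inter> V" "W \<inter> V"] by (auto simp: out_open openin_Int)
      moreover have "out (A - V) \<le> lam (W - K)"
        using W K out_mono[of "A - V" "W - K"] by (auto simp: out_open openin_diff)
      moreover have "ennreal (m K) + ennreal (m L) \<le> lam W"
      proof -
        have "ennreal (m K) + ennreal (m L) = ennreal (m (K \<union> L))"
          using L charge_nonneg[OF m] by (subst charge_Un[OF m]) (auto)
        also have "\<dots> \<le> lam W" using K L by (intro lam_ge) auto
        finally show ?thesis .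
      qed
      ultimately have "out (A \<inter> V) + out (A - V) \<le> (ennreal (m K) + ennreal (e/3)) + (ennreal (m L) + ennreal (e/3))"
        using K(3) L(3) by (meson add_mono order_trans)
      also have "\<dots> = (ennreal (m K) + ennreal (m L)) + (ennreal (e/3) + ennreal (e/3))"
        by (simp add: algebra_simps)
      also have "\<dots> \<le> (out A + ennreal (e/3)) + (ennreal (e/3) + ennreal (e/3))"
        using order_trans[OF \<open>ennreal (m K) + ennreal (m L) \<le> lam W\<close> W(3)]
        by (rule add_right_mono)
      also have "\<dots> = out A + (ennreal (e/3) + (ennreal (e/3) + ennreal (e/3)))"
        by (simp only: add.assoc)
      also have "ennreal (e/3) + (ennreal (e/3) + ennreal (e/3)) = ennreal e"
        using e by (simp flip: ennreal_plus)
      finally show "out (A \<inter> V) + out (A - V) \<le> out A + ennreal e" .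
    qed
  qed
  have sL: "sigma_algebra ?\<Omega> ?L" using ms by (simp add: measure_space_def)
  let ?B = "sigma_sets ?\<Omega> {U. openin X U}"
  have BL: "?B \<subseteq> ?L"
    using open_L by (intro sigma_algebra.sigma_sets_subset[OF sL]) auto
  have Pow: "{U. openin X U} \<subseteq> Pow ?\<Omega>" by (auto dest: openin_subset)
  have sB: "sigma_algebra ?\<Omega> ?B" using Pow by (rule sigma_algebra_sigma_sets)
  have msB: "measure_space ?\<Omega> ?B out"
    using measure_down[OF ms sB BL] .
  define \<mu> where "\<mu> = measure_of ?\<Omega> ?B out"
  have sp: "space \<mu> = ?\<Omega>"
    unfolding \<mu>_def using sigma_sets_into_sp[OF Pow] by (intro space_measure_of) blast
  have st: "sets \<mu> = ?B"
    unfolding \<mu>_def using sB by (simp add: sigma_algebra.sets_measure_of_eq)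
  have em: "emeasure \<mu> A = out A" if "A \<in> ?B" for A
    unfolding \<mu>_def using msB that by (intro emeasure_measure_of_sigma) (auto simp: measure_space_def)
  have stb: "sets \<mu> = sets (borel_measure_of X)"
    using Pow by (simp add: st borel_measure_of_def)
  have op: "U \<in> ?B" if "openin X U" for U using that by auto
  \<comment> \<open>The whole space is closed as well as open, so it loses no mass.\<close>
  have oneU: "out ?\<Omega> = 1"
  proof (rule antisym)
    have "ennreal (m ?\<Omega>) \<le> out ?\<Omega>"
      by (simp add: out_open lam_ge)
    then show "1 \<le> out ?\<Omega>" using m by (simp add: charge_def)
  qed (simp add: out_le1)
  have pr: "prob_space \<mu>"
    using oneU em[OF op[OF openin_topspace]] sp by (intro prob_spaceI) simp
  interpret P: prob_space \<mu> by (fact pr)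
  have outer: "emeasure \<mu> A = (INF U\<in>{U. openin X U \<and> A \<subseteq> U}. emeasure \<mu> U)" if "A \<in> sets \<mu>" for A
  proof -
    have "emeasure \<mu> A = out A" using that st em by simp
    also have "\<dots> = (INF U\<in>{U. openin X U \<and> A \<subseteq> U}. emeasure \<mu> U)"
      unfolding out_def[of A] using em op out_open by (intro INF_cong) auto
    finally show ?thesis .
  qed
  have inner: "emeasure \<mu> A = (SUP K\<in>{K. compactin X K \<and> K \<subseteq> A}. emeasure \<mu> K)" if A: "A \<in> sets \<mu>" for A
  proof (rule antisym)
    show "(SUP K\<in>{K. compactin X K \<and> K \<subseteq> A}. emeasure \<mu> K) \<le> emeasure \<mu> A"
      using A by (intro SUP_least emeasure_mono) auto
    show "emeasure \<mu> A \<le> (SUP K\<in>{K. compactin X K \<and> K \<subseteq> A}. emeasure \<mu> K)" (is "_ \<le> ?S")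
    proof (rule ennreal_le_epsilon)
      fix e :: real assume e: "0 < e"
      have AO: "A \<subseteq> ?\<Omega>" using sets.sets_into_space[OF A] sp by simp
      have CA: "?\<Omega> - A \<in> sets \<mu>" using sets.compl_sets[OF A] sp by simp
      \<comment> \<open>Inner regularity of \<open>A\<close> comes from outer approximation of its
        complement: the complement of \<open>W\<close> is closed, hence compact, and lies in
        \<open>A\<close>.\<close>
      obtain W where W: "openin X W" "?\<Omega> - A \<subseteq> W" "lam W \<le> out (?\<Omega> - A) + ennreal e"
        using out_approx[of e "?\<Omega> - A"] e by auto
      have Wm: "W \<in> sets \<mu>" using W op st by simp
      have "emeasure \<mu> W \<le> emeasure \<mu> (?\<Omega> - A) + ennreal e"
        using W em CA op st out_open by simp
      then have 1: "measure \<mu> W \<le> measure \<mu> (?\<Omega> - A) + e"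
        using e by (simp add: P.emeasure_eq_measure flip: ennreal_plus)
      let ?K = "?\<Omega> - W"
      have K: "compactin X ?K" "?K \<subseteq> A"
        using W by (auto intro!: closedin_compact_space[OF cp])
      have "measure \<mu> ?K = 1 - measure \<mu> W" "measure \<mu> (?\<Omega> - A) = 1 - measure \<mu> A"
        using P.prob_compl[OF Wm] P.prob_compl[OF A] unfolding sp by simp_all
      with 1 have "measure \<mu> A \<le> measure \<mu> ?K + e" by linarith
      then have "emeasure \<mu> A \<le> emeasure \<mu> ?K + ennreal e"
        using e by (simp add: P.emeasure_eq_measure flip: ennreal_plus)
      also have "\<dots> \<le> ?S + ennreal e"
        using K by (intro add_mono SUP_upper) auto
      finally show "emeasure \<mu> A \<le> ?S + ennreal e" .
    qed
  qed
  have "\<mu> \<in> regular_probs X"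
    unfolding regular_probs_def using pr sp stb outer inner by blast
  moreover have "measure \<mu> U \<le> m U" if "openin X U" for U
  proof -
    have "ennreal (measure \<mu> U) \<le> ennreal (m U)"
      using lam_le[of U] em[OF op[OF that]] out_open[OF that]
      by (simp flip: P.emeasure_eq_measure)
    then show ?thesis
      using charge_nonneg[OF m] by (simp add: ennreal_le_iff)
  qed
  ultimately show ?thesis by blast
qed

section \<open>Contractive actions and boundaries\<close>

lemma homeo_action_continuous:
  "homeo_action G X \<phi> \<Longrightarrow> g \<in> carrier G \<Longrightarrow> continuous_map X X (\<phi> g)"
  by (simp add: homeo_action_def homeomorphic_imp_continuous_map)

lemma homeo_action_closed:
  "homeo_action G X \<phi> \<Longrightarrow> g \<in> carrier G \<Longrightarrow> x \<in> topspace X \<Longrightarrow> \<phi> g x \<in> topspace X"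
  using group_action.element_image[of G "topspace X" \<phi>] by (simp add: homeo_action_def)

lemma homeo_action_mult:
  "homeo_action G X \<phi> \<Longrightarrow> g \<in> carrier G \<Longrightarrow> h \<in> carrier G \<Longrightarrow> x \<in> topspace X \<Longrightarrow>
    \<phi> (g \<otimes>\<^bsub>G\<^esub> h) x = \<phi> g (\<phi> h x)"
  using group_action.composition_rule[of G "topspace X" \<phi>] by (simp add: homeo_action_def)

lemma homeo_action_one:
  "homeo_action G X \<phi> \<Longrightarrow> x \<in> topspace X \<Longrightarrow> \<phi> \<one>\<^bsub>G\<^esub> x = x"
  using group_action.id_eq_one[of G "topspace X" \<phi>] by (metis homeo_action_def restrict_apply')

text \<open>The elements of \<open>BijGroup\<close> are extensional, hence the restriction.
  Continuity is enough because \<open>s (inv g)\<close> is a continuous inverse of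
  \<open>s g\<close>.\<close>

lemma homeo_actionI:
  assumes G: "group G"
    and cont: "\<And>g. g \<in> carrier G \<Longrightarrow> continuous_map X X (s g)"
    and mult: "\<And>g h x. g \<in> carrier G \<Longrightarrow> h \<in> carrier G \<Longrightarrow> x \<in> topspace X \<Longrightarrow>
      s (g \<otimes>\<^bsub>G\<^esub> h) x = s g (s h x)"
    and one: "\<And>x. x \<in> topspace X \<Longrightarrow> s \<one>\<^bsub>G\<^esub> x = x"
  shows "homeo_action G X (\<lambda>g. restrict (s g) (topspace X))"
proof -
  interpret group G by (fact G)
  have cl: "s g x \<in> topspace X" if "g \<in> carrier G" "x \<in> topspace X" for g x
    using continuous_map_image_subset_topspace[OF cont] that by blast
  have hm: "homeomorphic_maps X X (s g) (s (inv\<^bsub>G\<^esub> g))" if g: "g \<in> carrier G" for g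
    unfolding homeomorphic_maps_def
  proof (intro conjI ballI)
    fix x assume x: "x \<in> topspace X"
    show "s (inv\<^bsub>G\<^esub> g) (s g x) = x"
      using mult[of "inv\<^bsub>G\<^esub> g" g x] one[OF x] g x by simp
    show "s g (s (inv\<^bsub>G\<^esub> g) x) = x"
      using mult[of g "inv\<^bsub>G\<^esub> g" x] one[OF x] g x by simp
  qed (use g cont in auto)
  have hom: "homeomorphic_map X X (restrict (s g) (topspace X))" if "g \<in> carrier G" for g
    using homeomorphic_maps_map[of X X "s g" "s (inv\<^bsub>G\<^esub> g)"] hm[OF that]
    by (auto intro: homeomorphic_map_eq)
  have Bij: "restrict (s g) (topspace X) \<in> Bij (topspace X)" if "g \<in> carrier G" for g
    using homeomorphic_imp_injective_map[OF hom[OF that]]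
      homeomorphic_imp_surjective_map[OF hom[OF that]] by (simp add: Bij_def bij_betw_def)
  have "group_action G (topspace X) (\<lambda>g. restrict (s g) (topspace X))"
  proof -
    have "(\<lambda>g. restrict (s g) (topspace X)) \<in> hom G (BijGroup (topspace X))"
      unfolding hom_def BijGroup_def using Bij
      by (auto simp: compose_def mult cl intro!: restrict_ext)
    then show ?thesis
      by (simp add: group_action_def group_hom_def group_hom_axioms_def G group_BijGroup)
  qed
  with hom show ?thesis by (simp add: homeo_action_def)
qed

text \<open>\<open>N\<close> is any set and \<open>\<theta>\<close> any family, so that a subgroup
  acting through a conjugation fits as well. The set of \<open>x\<close> is not intersected with the
  space because a charge vanishes off it.\<close>

definition contractive :: "'x topology \<Rightarrow> 'g set \<Rightarrow> ('g \<Rightarrow> 'x \<Rightarrow> 'x) \<Rightarrow> bool" where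
  "contractive X N \<theta> \<longleftrightarrow> (\<forall>U e. openin X U \<longrightarrow> U \<noteq> {} \<longrightarrow> 0 < e \<longrightarrow>
     (\<exists>F\<subseteq>N. finite F \<and> (\<forall>m. charge (topspace X) m \<longrightarrow> (\<exists>g\<in>F. 1 - e \<le> m {x. \<theta> g x \<in> U}))))"

text \<open>The mean of the two point masses takes only the values 0, 1/2 and 1, so a mass of at
  least 3/4 catches both points.\<close>

lemma contractive_pair:
  assumes "contractive X N \<theta>" "openin X U" "U \<noteq> {}" "x \<in> topspace X" "y \<in> topspace X"
  obtains g where "g \<in> N" "\<theta> g x \<in> U" "\<theta> g y \<in> U"
proof -
  have c: "charge (topspace X) (\<lambda>A. (of_bool (x \<in> A) + of_bool (y \<in> A)) / 2)"
    using assms by (intro charge_average charge_dirac)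
  obtain F where F: "F \<subseteq> N"
    "\<And>m. charge (topspace X) m \<Longrightarrow> \<exists>g\<in>F. 1 - 1/4 \<le> m {x. \<theta> g x \<in> U}"
    using assms(1)[unfolded contractive_def, rule_format, of U "1/4"] assms(2,3) by auto
  obtain g where "g \<in> F"
    "1 - 1/4 \<le> (of_bool (x \<in> {x. \<theta> g x \<in> U}) + of_bool (y \<in> {x. \<theta> g x \<in> U})) / (2::real)"
    using F(2)[OF c] by blast
  with F(1) show ?thesis
    by (intro that[of g]) (auto split: if_splits simp: of_bool_def)
qed

lemma contractive_invariant_closed:
  assumes "contractive X N \<theta>" "closedin X S" "\<And>g. g \<in> N \<Longrightarrow> \<theta> g ` S \<subseteq> S"
  shows "S = {} \<or> S = topspace X"
proof (rule ccontr)
  assume neg: "\<not> ?thesis"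
  then obtain x where x: "x \<in> S" by blast
  have S: "S \<subseteq> topspace X" using assms(2) by (simp add: closedin_subset)
  obtain g where "g \<in> N" "\<theta> g x \<in> topspace X - S"
    using contractive_pair[OF assms(1), of "topspace X - S" x x] assms(2) neg S x by blast
  with assms(3) x show False by blast
qed

section \<open>Regular Borel probabilities and weak-star convergence\<close>

lemma space_borel_measure_of: "space (borel_measure_of X) = topspace X"
  by (simp add: borel_measure_of_def openin_subset space_measure_of_conv)

lemma sets_borel_measure_of: "sets (borel_measure_of X) = sigma_sets (topspace X) {U. openin X U}"
  by (auto simp: borel_measure_of_def openin_subset intro!: sets_measure_of dest: openin_subset)

lemma openin_sets_borel_measure_of: "openin X U \<Longrightarrow> U \<in> sets (borel_measure_of X)"
  by (simp add: sets_borel_measure_of)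

lemma closedin_sets_borel_measure_of: "closedin X K \<Longrightarrow> K \<in> sets (borel_measure_of X)"
  using sets.compl_sets[of "topspace X - K" "borel_measure_of X"]
  by (auto simp: closedin_def openin_sets_borel_measure_of space_borel_measure_of double_diff)

lemma continuous_map_measurable:
  assumes "continuous_map X Y f"
  shows "f \<in> borel_measure_of X \<rightarrow>\<^sub>M borel_measure_of Y"
  unfolding borel_measure_of_def[of Y]
proof (rule measurable_measure_of)
  show "{U. openin Y U} \<subseteq> Pow (topspace Y)" by (auto dest: openin_subset)
  show "f \<in> space (borel_measure_of X) \<rightarrow> topspace Y"
    using assms by (auto simp: space_borel_measure_of continuous_map_def)
  fix U assume "U \<in> {U. openin Y U}"
  then have "openin X {x \<in> topspace X. f x \<in> U}"
    using assms by (auto intro: openin_continuous_map_preimage)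
  then show "f -` U \<inter> space (borel_measure_of X) \<in> sets (borel_measure_of X)"
    by (auto simp: space_borel_measure_of vimage_def Int_def conj_commute
        intro!: openin_sets_borel_measure_of)
qed

lemma continuous_map_real_measurable:
  assumes "continuous_map X euclideanreal f"
  shows "f \<in> borel_measurable (borel_measure_of X)"
proof (rule borel_measurableI)
  fix S :: "real set" assume "open S"
  then have "openin X {x \<in> topspace X. f x \<in> S}"
    using assms by (auto intro: openin_continuous_map_preimage)
  then show "f -` S \<inter> space (borel_measure_of X) \<in> sets (borel_measure_of X)"
    by (auto simp: space_borel_measure_of vimage_def Int_def conj_commute
        intro!: openin_sets_borel_measure_of)
qed

lemma regular_probsD:
  assumes "\<mu> \<in> regular_probs X"
  shows "prob_space \<mu>" "space \<mu> = topspace X" "sets \<mu> = sets (borel_measure_of X)"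
  using assms by (auto simp: regular_probs_def)

lemma regular_probs_return:
  assumes H: "Hausdorff_space X" and x: "x \<in> topspace X"
  shows "return (borel_measure_of X) x \<in> regular_probs X"
  unfolding regular_probs_def
proof (intro CollectI conjI ballI)
  let ?B = "borel_measure_of X" let ?r = "return ?B x"
  show "prob_space ?r"
    using x by (intro prob_space_return) (simp add: space_borel_measure_of)
  show "space ?r = topspace X" by (simp add: space_borel_measure_of)
  show "sets ?r = sets ?B" by simp
  have sx: "closedin X {x}" using H x by (simp add: closedin_Hausdorff_singleton)
  have K: "K \<in> sets ?B" if "compactin X K" for K
    using that H by (intro closedin_sets_borel_measure_of) (simp add: compactin_imp_closedin)
  fix A assume "A \<in> sets ?r"
  then have A: "A \<in> sets ?B" by simp
  then have AX: "A \<subseteq> topspace X" using sets.sets_into_space by (force simp: space_borel_measure_of)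
  show "emeasure ?r A = (SUP K\<in>{K. compactin X K \<and> K \<subseteq> A}. emeasure ?r K)"
  proof (rule antisym)
    show "(SUP K\<in>{K. compactin X K \<and> K \<subseteq> A}. emeasure ?r K) \<le> emeasure ?r A"
      using A by (intro SUP_least emeasure_mono) auto
    show "emeasure ?r A \<le> (SUP K\<in>{K. compactin X K \<and> K \<subseteq> A}. emeasure ?r K)"
    proof (cases "x \<in> A")
      case True
      then have "emeasure ?r A = emeasure ?r {x}"
        using A K[of "{x}"] x by simp
      also have "\<dots> \<le> (SUP K\<in>{K. compactin X K \<and> K \<subseteq> A}. emeasure ?r K)"
        using True x by (intro SUP_upper) auto
      finally show ?thesis .
    qed (use A in simp)
  qed
  show "emeasure ?r A = (INF U\<in>{U. openin X U \<and> A \<subseteq> U}. emeasure ?r U)"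
  proof (rule antisym)
    show "emeasure ?r A \<le> (INF U\<in>{U. openin X U \<and> A \<subseteq> U}. emeasure ?r U)"
      by (intro INF_greatest emeasure_mono) (auto simp: openin_sets_borel_measure_of)
    show "(INF U\<in>{U. openin X U \<and> A \<subseteq> U}. emeasure ?r U) \<le> emeasure ?r A"
    proof (cases "x \<in> A")
      case False
      have O: "openin X (topspace X - {x})" using sx by blast
      have "(INF U\<in>{U. openin X U \<and> A \<subseteq> U}. emeasure ?r U) \<le> emeasure ?r (topspace X - {x})"
        using False AX O by (intro INF_lower) auto
      also have "\<dots> = 0" using openin_sets_borel_measure_of[OF O] by simp
      finally show ?thesis by simp
    next
      case True
      have "(INF U\<in>{U. openin X U \<and> A \<subseteq> U}. emeasure ?r U) \<le> emeasure ?r (topspace X)"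
        using AX by (intro INF_lower) auto
      also have "\<dots> = emeasure ?r A"
        using True x A openin_sets_borel_measure_of[of X "topspace X"] by simp
      finally show ?thesis .
    qed
  qed
qed

lemma regular_probs_distr:
  assumes H: "Hausdorff_space X" and f: "homeomorphic_map X X f" and \<mu>: "\<mu> \<in> regular_probs X"
  shows "distr \<mu> (borel_measure_of X) f \<in> regular_probs X"
  unfolding regular_probs_def
proof (intro CollectI conjI ballI)
  let ?B = "borel_measure_of X" let ?d = "distr \<mu> ?B f"
  note [simp] = regular_probsD(2,3)[OF \<mu>]
  have cf: "continuous_map X X f" and inj: "inj_on f (topspace X)" and sur: "f ` topspace X = topspace X"
    using f by (auto simp: homeomorphic_imp_continuous_map homeomorphic_imp_injective_map
        homeomorphic_imp_surjective_map)
  have mf: "f \<in> \<mu> \<rightarrow>\<^sub>M ?B"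
    using continuous_map_measurable[OF cf] regular_probsD(3)[OF \<mu>]
    by (simp cong: measurable_cong_sets)
  interpret prob_space \<mu> using \<mu> by (rule regular_probsD)
  show "prob_space ?d" using mf by (rule prob_space_distr)
  show "space ?d = topspace X" by (simp add: space_borel_measure_of)
  show "sets ?d = sets ?B" by simp
  have em: "emeasure ?d A = emeasure \<mu> (f -` A \<inter> topspace X)" if "A \<in> sets ?B" for A
    using mf that by (simp add: emeasure_distr)
  have K: "K \<in> sets ?B" if "compactin X K" for K
    using that H by (intro closedin_sets_borel_measure_of) (simp add: compactin_imp_closedin)
  have im: "f -` (f ` V) \<inter> topspace X = V" if "V \<subseteq> topspace X" for V
    using inj that by (auto dest: inj_onD)
  fix A assume "A \<in> sets ?d"
  then have A: "A \<in> sets ?B" by simp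
  then have AX: "A \<subseteq> topspace X" using sets.sets_into_space by (force simp: space_borel_measure_of)
  let ?A = "f -` A \<inter> topspace X"
  have A': "?A \<in> sets \<mu>" using measurable_sets[OF mf A] by simp
  show "emeasure ?d A = (SUP K\<in>{K. compactin X K \<and> K \<subseteq> A}. emeasure ?d K)"
  proof (rule antisym)
    show "(SUP K\<in>{K. compactin X K \<and> K \<subseteq> A}. emeasure ?d K) \<le> emeasure ?d A"
      using A by (intro SUP_least emeasure_mono) auto
    have "emeasure ?d A = (SUP K\<in>{K. compactin X K \<and> K \<subseteq> ?A}. emeasure \<mu> K)"
      using \<mu> A' em[OF A] by (simp add: regular_probs_def)
    also have "\<dots> \<le> (SUP K\<in>{K. compactin X K \<and> K \<subseteq> A}. emeasure ?d K)"
    proof (rule SUP_least, clarify)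
      fix L assume L: "compactin X L" "L \<subseteq> ?A"
      have fL: "compactin X (f ` L)" using L cf by (simp add: image_compactin)
      have "emeasure \<mu> L = emeasure ?d (f ` L)"
        using em[OF K[OF fL]] im[of L] L by simp
      also have "\<dots> \<le> (SUP K\<in>{K. compactin X K \<and> K \<subseteq> A}. emeasure ?d K)"
        using fL L by (intro SUP_upper) auto
      finally show "emeasure \<mu> L \<le> (SUP K\<in>{K. compactin X K \<and> K \<subseteq> A}. emeasure ?d K)" .
    qed
    finally show "emeasure ?d A \<le> (SUP K\<in>{K. compactin X K \<and> K \<subseteq> A}. emeasure ?d K)" .
  qed
  show "emeasure ?d A = (INF U\<in>{U. openin X U \<and> A \<subseteq> U}. emeasure ?d U)"
  proof (rule antisym)
    show "emeasure ?d A \<le> (INF U\<in>{U. openin X U \<and> A \<subseteq> U}. emeasure ?d U)"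
      by (intro INF_greatest emeasure_mono) (auto simp: openin_sets_borel_measure_of)
    have "(INF U\<in>{U. openin X U \<and> A \<subseteq> U}. emeasure ?d U) \<le> (INF U\<in>{U. openin X U \<and> ?A \<subseteq> U}. emeasure \<mu> U)"
    proof (rule INF_greatest, clarify)
      fix W assume W: "openin X W" "?A \<subseteq> W"
      have fW: "openin X (f ` W)"
        using homeomorphic_imp_open_map[OF f] W by (simp add: open_map_def)
      have WX: "W \<subseteq> topspace X" using W by (simp add: openin_subset)
      have "A \<subseteq> f ` W"
      proof
        fix a assume a: "a \<in> A"
        then obtain b where "b \<in> topspace X" "a = f b" using AX sur by blast
        with a W show "a \<in> f ` W" by auto
      qed
      then have "(INF U\<in>{U. openin X U \<and> A \<subseteq> U}. emeasure ?d U) \<le> emeasure ?d (f ` W)"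
        using fW by (intro INF_lower) auto
      also have "\<dots> = emeasure \<mu> W"
        using em[OF openin_sets_borel_measure_of[OF fW]] im[OF WX] by simp
      finally show "(INF U\<in>{U. openin X U \<and> A \<subseteq> U}. emeasure ?d U) \<le> emeasure \<mu> W" .
    qed
    also have "\<dots> = emeasure \<mu> ?A"
    proof -
      have "\<forall>A\<in>sets \<mu>. emeasure \<mu> A = (INF U\<in>{U. openin X U \<and> A \<subseteq> U}. emeasure \<mu> U)"
        using \<mu> unfolding regular_probs_def by blast
      from bspec[OF this A'] show ?thesis by (rule sym)
    qed
    also have "\<dots> = emeasure ?d A" by (simp add: em[OF A])
    finally show "(INF U\<in>{U. openin X U \<and> A \<subseteq> U}. emeasure ?d U) \<le> emeasure ?d A" .
  qed
qed

lemma topspace_Prob_topology: "topspace (Prob_topology X) = regular_probs X"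
  by (auto simp: Prob_topology_def topspace_pullback_topology)

text \<open>\<open>limitin\<close> forces the net eventually into the space itself, which
  convergence of the integrals alone would not; hence the second conjunct.\<close>

lemma limitin_Prob_topology:
  "limitin (Prob_topology X) \<mu> \<nu> F \<longleftrightarrow> \<nu> \<in> regular_probs X \<and>
     (\<forall>\<^sub>F i in F. \<mu> i \<in> regular_probs X) \<and>
     (\<forall>f. continuous_map X euclideanreal f \<longrightarrow> ((\<lambda>i. \<integral>x. f x \<partial>\<mu> i) \<longlongrightarrow> (\<integral>x. f x \<partial>\<nu>)) F)"
    (is "?L \<longleftrightarrow> ?R")
proof -
  define C where "C = {f. continuous_map X euclideanreal f}"
  define I where "I \<mu> = (\<lambda>f\<in>C. \<integral>x. f x \<partial>\<mu>)" for \<mu> :: "'a measure"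
  define T where "T = product_topology (\<lambda>_. euclideanreal) C"
  have P: "Prob_topology X = pullback_topology (regular_probs X) I T"
    by (simp add: Prob_topology_def I_def[abs_def] C_def T_def)
  have lT: "limitin T (I \<circ> \<mu>) (I \<nu>) F \<longleftrightarrow>
      (\<forall>f. continuous_map X euclideanreal f \<longrightarrow> ((\<lambda>i. \<integral>x. f x \<partial>\<mu> i) \<longlongrightarrow> (\<integral>x. f x \<partial>\<nu>)) F)"
    unfolding T_def limitin_componentwise by (auto simp: I_def C_def)
  show ?thesis
  proof
    assume L: ?L
    have "continuous_map (Prob_topology X) T (id \<circ> I)"
      unfolding P by (rule continuous_map_pullback) (rule continuous_map_id)
    then have "limitin T (I \<circ> \<mu>) (I \<nu>) F"
      using L by (simp add: continuous_map_limit)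
    moreover have "\<nu> \<in> regular_probs X" "\<forall>\<^sub>F i in F. \<mu> i \<in> regular_probs X"
      using L openin_topspace[of "Prob_topology X"]
      unfolding limitin_def topspace_Prob_topology by blast+
    ultimately show ?R by (simp add: lT)
  next
    assume R: ?R
    then have lim: "limitin T (I \<circ> \<mu>) (I \<nu>) F" by (simp add: lT)
    show ?L
      unfolding limitin_def topspace_Prob_topology
    proof (intro conjI allI impI)
      show "\<nu> \<in> regular_probs X" using R by blast
      fix U assume U: "openin (Prob_topology X) U \<and> \<nu> \<in> U"
      then obtain W where W: "openin T W" "U = I -` W \<inter> regular_probs X"
        by (auto simp: P openin_pullback_topology)
      have "\<forall>\<^sub>F i in F. (I \<circ> \<mu>) i \<in> W"
        using lim U W unfolding limitin_def by blast
      moreover have "\<forall>\<^sub>F i in F. \<mu> i \<in> regular_probs X" using R by blast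
      ultimately show "\<forall>\<^sub>F i in F. \<mu> i \<in> U"
        by eventually_elim (simp add: W)
    qed
  qed
qed

text \<open>Collapsing each atom of the finite Boolean algebra generated by the preimages of \<open>U\<close> to a
  point turns a Borel measure into a charge on all subsets.\<close>

lemma contractive_measures:
  assumes con: "contractive X N \<theta>"
    and cont: "\<And>g. g \<in> N \<Longrightarrow> continuous_map X X (\<theta> g)"
    and \<mu>: "\<mu> \<in> regular_probs X" and \<nu>: "\<nu> \<in> regular_probs X"
    and U: "openin X U" "U \<noteq> {}" and e: "0 < e"
  shows "\<exists>g\<in>N. 1 - e \<le> measure \<mu> (\<theta> g -` U \<inter> topspace X) \<and>
    1 - e \<le> measure \<nu> (\<theta> g -` U \<inter> topspace X)"
proof -
  \<comment> \<open>Half of \<open>e\<close> pays for averaging the two charges: both masses are at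
    most 1, so an average of at least \<open>1 - e/2\<close> makes each at least
    \<open>1 - e\<close>.\<close>
  obtain F where F: "F \<subseteq> N" "finite F"
    "\<And>m. charge (topspace X) m \<Longrightarrow> \<exists>g\<in>F. 1 - e/2 \<le> m {x. \<theta> g x \<in> U}"
    using con[unfolded contractive_def, rule_format, of U "e/2"] U e by auto
  define c where "c x = {g\<in>F. \<theta> g x \<in> U}" for x
  define r where "r x = (SOME y. y \<in> topspace X \<and> c y = c x)" for x
  have r: "r x \<in> topspace X" "c (r x) = c x" if "x \<in> topspace X" for x
    unfolding r_def using someI[of "\<lambda>y. y \<in> topspace X \<and> c y = c x" x] that by auto
  have r_cong: "r x = r y" if "c x = c y" for x y
    unfolding r_def that ..
  have meas: "r -` A \<inter> topspace X \<in> sets (borel_measure_of X)" for A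
  proof -
    have c1: "{x \<in> topspace X. \<theta> g x \<in> U} \<in> sets (borel_measure_of X)" if "g \<in> F" for g
      using that F(1) U cont
      by (intro openin_sets_borel_measure_of openin_continuous_map_preimage[of X X]) auto
    have c2: "{x \<in> topspace X. c x = B} \<in> sets (borel_measure_of X)" if "B \<subseteq> F" for B
    proof -
      have "{x \<in> topspace X. c x = B} = {x \<in> space (borel_measure_of X). \<forall>g\<in>F. (\<theta> g x \<in> U \<longleftrightarrow> g \<in> B)}"
        using that by (auto simp: c_def space_borel_measure_of)
      also have "\<dots> \<in> sets (borel_measure_of X)"
      proof (rule sets.sets_Collect_finite_All[OF _ F(2)])
        fix g assume "g \<in> F"
        note * = c1[OF this] sets.compl_sets[OF c1[OF this]]
        have "{x \<in> space (borel_measure_of X). (\<theta> g x \<in> U) = (g \<in> B)} =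
          (if g \<in> B then {x \<in> topspace X. \<theta> g x \<in> U}
           else space (borel_measure_of X) - {x \<in> topspace X. \<theta> g x \<in> U})"
          by (auto simp: space_borel_measure_of)
        with * show "{x \<in> space (borel_measure_of X). (\<theta> g x \<in> U) = (g \<in> B)} \<in> sets (borel_measure_of X)"
          by simp
      qed
      finally show ?thesis .
    qed
    let ?\<B> = "{B. B \<subseteq> F \<and> (\<exists>x\<in>topspace X. c x = B \<and> r x \<in> A)}"
    have "r -` A \<inter> topspace X = (\<Union>B\<in>?\<B>. {x \<in> topspace X. c x = B})"
    proof (intro equalityI subsetI)
      fix x assume "x \<in> r -` A \<inter> topspace X"
      then show "x \<in> (\<Union>B\<in>?\<B>. {x \<in> topspace X. c x = B})"
        by (auto simp: c_def)
    next
      fix x assume "x \<in> (\<Union>B\<in>?\<B>. {x \<in> topspace X. c x = B})"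
      then obtain y where "x \<in> topspace X" "c y = c x" "r y \<in> A" by auto
      then show "x \<in> r -` A \<inter> topspace X" using r_cong[of y x] by simp
    qed
    also have "\<dots> \<in> sets (borel_measure_of X)"
      using F(2) c2 by (intro sets.finite_UN) auto
    finally show ?thesis .
  qed
  have ch: "charge (topspace X) (\<lambda>A. measure \<mu> (r -` A \<inter> topspace X))" if \<mu>: "\<mu> \<in> regular_probs X" for \<mu>
  proof -
    interpret prob_space \<mu> using \<mu> by (rule regular_probsD)
    have "r -` topspace X \<inter> topspace X = space \<mu>" "UNIV \<inter> topspace X = space \<mu>"
      using r regular_probsD(2)[OF \<mu>] by auto
    moreover have "measure \<mu> ((r -` A \<inter> topspace X) \<union> (r -` B \<inter> topspace X)) =
        measure \<mu> (r -` A \<inter> topspace X) + measure \<mu> (r -` B \<inter> topspace X)" if "A \<inter> B = {}" for A B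
      using that meas regular_probsD(3)[OF \<mu>] by (intro finite_measure_Union) auto
    ultimately show ?thesis
      by (simp add: charge_def prob_space vimage_Un Int_Un_distrib2)
  qed
  obtain g where g: "g \<in> F" "1 - e/2 \<le> (measure \<mu> (r -` {x. \<theta> g x \<in> U} \<inter> topspace X) +
      measure \<nu> (r -` {x. \<theta> g x \<in> U} \<inter> topspace X)) / 2"
    using F(3)[OF charge_average[OF ch[OF \<mu>] ch[OF \<nu>]]] by blast
  have "\<theta> g (r x) \<in> U \<longleftrightarrow> \<theta> g x \<in> U" if "x \<in> topspace X" for x
    using r(2)[OF that] g(1) by (auto simp: c_def)
  then have "r -` {x. \<theta> g x \<in> U} \<inter> topspace X = \<theta> g -` U \<inter> topspace X" by auto
  then have "1 - e/2 \<le> (measure \<mu> (\<theta> g -` U \<inter> topspace X) + measure \<nu> (\<theta> g -` U \<inter> topspace X)) / 2"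
    using g(2) by simp
  moreover have "measure \<mu> (\<theta> g -` U \<inter> topspace X) \<le> 1" "measure \<nu> (\<theta> g -` U \<inter> topspace X) \<le> 1"
    using regular_probsD(1)[OF \<mu>] regular_probsD(1)[OF \<nu>] by (simp_all add: prob_space.prob_le_1)
  ultimately have "1 - e \<le> measure \<mu> (\<theta> g -` U \<inter> topspace X)"
    "1 - e \<le> measure \<nu> (\<theta> g -` U \<inter> topspace X)"
    by (auto simp: field_simps)
  with g(1) F(1) show ?thesis by blast
qed

section \<open>From contraction to strong proximality\<close>

lemma continuous_map_real_bounded:
  assumes "compact_space X" "continuous_map X euclideanreal f"
  obtains b where "0 \<le> b" "\<And>x. x \<in> topspace X \<Longrightarrow> \<bar>f x\<bar> \<le> b"
proof -
  have "compact (f ` topspace X)"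
    using image_compactin[OF _ assms(2)] assms(1) by (simp add: compact_space_def)
  then obtain b where "\<forall>y\<in>f ` topspace X. norm y \<le> b"
    using compact_imp_bounded bounded_iff by metis
  then show ?thesis by (intro that[of "max b 0"]) auto
qed

text \<open>The distance of \<open>f\<close> to \<open>a\<close> is at most \<open>d\<close> plus
  \<open>b\<close> times the indicator of the complement of \<open>U\<close>, and this complement
  has measure at most \<open>e\<close>.\<close>

lemma integral_near_of_concentrated:
  assumes \<mu>: "\<mu> \<in> regular_probs X" and f: "continuous_map X euclideanreal f"
    and b: "0 \<le> b" "\<And>x. x \<in> topspace X \<Longrightarrow> \<bar>f x - a\<bar> \<le> b"
    and U: "openin X U" "\<And>x. x \<in> U \<Longrightarrow> \<bar>f x - a\<bar> \<le> d" and d: "0 \<le> d"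
    and e: "1 - e \<le> measure \<mu> U"
  shows "\<bar>(\<integral>x. f x \<partial>\<mu>) - a\<bar> \<le> d + b * e"
proof -
  interpret prob_space \<mu> using \<mu> by (rule regular_probsD)
  note [simp] = regular_probsD(2,3)[OF \<mu>]
  have mf: "f \<in> borel_measurable \<mu>"
    using continuous_map_real_measurable[OF f] by (simp cong: measurable_cong_sets)
  have mU: "U \<in> sets \<mu>" using U by (simp add: openin_sets_borel_measure_of)
  then have mC: "topspace X - U \<in> sets \<mu>" using sets.compl_sets[of U \<mu>] by simp
  have [simp]: "(topspace X - U) \<inter> topspace X = topspace X - U" by blast
  have pt: "prob (topspace X) = 1" using prob_space by simp
  have i1: "integrable \<mu> (\<lambda>x. f x - a)"
    using mf b(2) by (intro integrable_const_bound[where B = b]) auto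
  then have i2: "integrable \<mu> f"
    using Bochner_Integration.integrable_add[OF i1, of "\<lambda>_. a"] by simp
  have i3: "integrable \<mu> (\<lambda>x. d + b * indicat_real (topspace X - U) x)"
    using mC by (intro Bochner_Integration.integrable_add integrable_mult_right)
      (auto simp: integrable_indicator_iff emeasure_eq_measure)
  have "(\<integral>x. f x \<partial>\<mu>) - a = (\<integral>x. f x - a \<partial>\<mu>)"
    using i2 by (subst Bochner_Integration.integral_diff) (auto simp: pt)
  also have "\<bar>\<dots>\<bar> \<le> (\<integral>x. \<bar>f x - a\<bar> \<partial>\<mu>)"
    by (rule integral_abs_bound)
  also have "\<dots> \<le> (\<integral>x. d + b * indicat_real (topspace X - U) x \<partial>\<mu>)"
    using i1 i3 b U(2) d by (intro integral_mono integrable_abs) (auto simp: indicator_def intro: order_trans[of _ b])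
  also have "\<dots> = d + b * measure \<mu> (topspace X - U)"
    using mC by (subst Bochner_Integration.integral_add)
      (auto simp: integrable_indicator_iff emeasure_eq_measure pt)
  also have "\<dots> \<le> d + b * e"
    using e b(1) prob_compl[OF mU] by (intro add_left_mono mult_left_mono) auto
  finally show ?thesis .
qed

text \<open>Any point \<open>z\<close> of the space serves: both measures are driven to the point
  mass at \<open>z\<close>.\<close>

theorem contractive_imp_strongly_proximal:
  assumes cp: "compact_space X" and H: "Hausdorff_space X" and ne: "topspace X \<noteq> {}"
    and ho: "homeo_action G X \<phi>" and con: "contractive X (carrier G) \<phi>"
  shows "strongly_proximal_action G X \<phi>"
  unfolding strongly_proximal_action_def proximal_action_def topspace_Prob_topology
proof (intro ballI)
  fix \<mu> \<nu> assume \<mu>: "\<mu> \<in> regular_probs X" and \<nu>: "\<nu> \<in> regular_probs X"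
  let ?B = "borel_measure_of X"
  obtain z where z: "z \<in> topspace X" using ne by blast
  \<comment> \<open>The elements that move all but mass \<open>e\<close> of both measures into the
    neighbourhood \<open>U\<close> of \<open>z\<close>. These sets form the base of the filter that
    stands for the net.\<close>
  define S where "S = (\<lambda>(U, e). {g \<in> carrier G. 1 - e \<le> measure \<mu> (\<phi> g -` U \<inter> topspace X) \<and>
    1 - e \<le> measure \<nu> (\<phi> g -` U \<inter> topspace X)})"
  define I where "I = {(U, e::real). openin X U \<and> z \<in> U \<and> 0 < e}"
  define F where "F = (INF i\<in>I. principal (S i))"
  have cont: "continuous_map X X (\<phi> g)" if "g \<in> carrier G" for g
    using homeo_action_continuous[OF ho that] .
  have reg: "distr \<kappa> ?B (\<phi> g) \<in> regular_probs X" if "\<kappa> \<in> regular_probs X" "g \<in> carrier G" for \<kappa> g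
    using that ho H by (intro regular_probs_distr) (auto simp: homeo_action_def)
  have mg: "measure (distr \<kappa> ?B (\<phi> g)) U = measure \<kappa> (\<phi> g -` U \<inter> topspace X)"
    if "\<kappa> \<in> regular_probs X" "g \<in> carrier G" "openin X U" for \<kappa> g U
  proof -
    have "\<phi> g \<in> \<kappa> \<rightarrow>\<^sub>M ?B"
      using continuous_map_measurable[OF cont] regular_probsD(3)[OF that(1)] that(2)
      by (simp cong: measurable_cong_sets)
    then show ?thesis
      using that by (simp add: measure_distr openin_sets_borel_measure_of regular_probsD(2))
  qed
  have pre: "\<phi> g -` U \<inter> topspace X \<in> sets ?B" if "openin X U" "g \<in> carrier G" for U g
    using measurable_sets[OF continuous_map_measurable[OF cont] openin_sets_borel_measure_of] that
    by (simp add: space_borel_measure_of)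
  have mono: "measure \<kappa> (\<phi> g -` U \<inter> topspace X) \<le> measure \<kappa> (\<phi> g -` V \<inter> topspace X)"
    if "\<kappa> \<in> regular_probs X" "g \<in> carrier G" "openin X V" "U \<subseteq> V" for \<kappa> g U V
    using that pre regular_probsD[OF that(1)]
    by (intro finite_measure.finite_measure_mono) (auto simp: prob_space_def)
  have base: "eventually P F \<longleftrightarrow> (\<exists>i\<in>I. eventually P (principal (S i)))" for P
    unfolding F_def
  proof (rule eventually_INF_base)
    show "I \<noteq> {}" using z by (auto simp: I_def intro!: exI[of _ "topspace X"] exI[of _ 1])
    fix i j assume ij: "i \<in> I" "j \<in> I"
    obtain U d V e where [simp]: "i = (U, d)" "j = (V, e)" by (cases i, cases j)
    have UV: "openin X U" "openin X V" using ij by (auto simp: I_def)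
    have "(U \<inter> V, min d e) \<in> I" using ij by (auto simp: I_def openin_Int)
    moreover have "S (U \<inter> V, min d e) \<subseteq> S i \<inter> S j"
    proof
      fix g assume g: "g \<in> S (U \<inter> V, min d e)"
      then have gG: "g \<in> carrier G" by (simp add: S_def)
      note mono[OF \<mu> gG UV(1), of "U \<inter> V"] mono[OF \<mu> gG UV(2), of "U \<inter> V"]
        mono[OF \<nu> gG UV(1), of "U \<inter> V"] mono[OF \<nu> gG UV(2), of "U \<inter> V"]
      with g show "g \<in> S i \<inter> S j" unfolding S_def by auto
    qed
    ultimately show "\<exists>k\<in>I. principal (S k) \<le> inf (principal (S i)) (principal (S j))"
      by (intro bexI[of _ "(U \<inter> V, min d e)"]) auto
  qed
  have "S i \<noteq> {}" if "i \<in> I" for i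
  proof -
    obtain U e where i: "i = (U, e)" by (cases i)
    then have "\<exists>g\<in>carrier G. 1 - e \<le> measure \<mu> (\<phi> g -` U \<inter> topspace X) \<and>
        1 - e \<le> measure \<nu> (\<phi> g -` U \<inter> topspace X)"
      using that by (intro contractive_measures[OF con cont \<mu> \<nu>]) (auto simp: I_def)
    then show ?thesis by (auto simp: i S_def)
  qed
  then have Fnb: "F \<noteq> bot"
    unfolding trivial_limit_def base by (simp add: eventually_principal)
  have evG: "\<forall>\<^sub>F g in F. g \<in> carrier G"
    unfolding base eventually_principal using z
    by (intro bexI[of _ "(topspace X, 1)"]) (auto simp: I_def S_def)
  have ret: "return ?B z \<in> regular_probs X" using H z by (rule regular_probs_return)
  have lim: "limitin (Prob_topology X) (\<lambda>g. distr \<kappa> ?B (\<phi> g)) (return ?B z) F"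
    if \<kappa>: "\<kappa> \<in> regular_probs X" and S\<kappa>: "\<And>U e g. g \<in> S (U, e) \<Longrightarrow> 1 - e \<le> measure \<kappa> (\<phi> g -` U \<inter> topspace X)" for \<kappa>
    unfolding limitin_Prob_topology
  proof (intro conjI allI impI)
    show "\<forall>\<^sub>F g in F. distr \<kappa> ?B (\<phi> g) \<in> regular_probs X"
      using evG by eventually_elim (rule reg[OF \<kappa>])
    fix f assume f: "continuous_map X euclideanreal f"
    have fz: "(\<integral>x. f x \<partial>return ?B z) = f z"
      using f z by (intro integral_return) (auto simp: space_borel_measure_of continuous_map_real_measurable)
    show "((\<lambda>g. \<integral>x. f x \<partial>distr \<kappa> ?B (\<phi> g)) \<longlongrightarrow> (\<integral>x. f x \<partial>return ?B z)) F"
      unfolding fz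
    proof (rule tendstoI)
      fix \<eta> :: real assume \<eta>: "0 < \<eta>"
      have "continuous_map X euclideanreal (\<lambda>x. f x - f z)"
        using f by (intro continuous_intros) auto
      then obtain b where b: "0 \<le> b" "\<And>x. x \<in> topspace X \<Longrightarrow> \<bar>f x - f z\<bar> \<le> b"
        using continuous_map_real_bounded[OF cp, of "\<lambda>x. f x - f z"] by metis
      define U where "U = {x \<in> topspace X. f x \<in> ball (f z) (\<eta>/2)}"
      \<comment> \<open>The summand 1 keeps \<open>e\<close> positive also for \<open>b = 0\<close>.
        Then \<open>b * e \<le> \<eta> / 4\<close>, and
        \<open>\<eta>/2 + \<eta>/4 < \<eta>\<close>.\<close>
      define e where "e = \<eta> / (4 * (b + 1))"
      have U: "openin X U" unfolding U_def using f by (rule openin_continuous_map_preimage) simp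
      have e: "0 < e" using \<eta> b(1) by (simp add: e_def)
      have be: "b * e \<le> \<eta> / 4"
        using \<eta> b(1) by (simp add: e_def field_simps)
      have "(U, e) \<in> I" using U e z \<eta> by (simp add: I_def U_def)
      moreover have "dist (\<integral>x. f x \<partial>distr \<kappa> ?B (\<phi> g)) (f z) < \<eta>" if g: "g \<in> S (U, e)" for g
      proof -
        have gG: "g \<in> carrier G" using g by (simp add: S_def)
        have "\<bar>(\<integral>x. f x \<partial>distr \<kappa> ?B (\<phi> g)) - f z\<bar> \<le> \<eta>/2 + b * e"
          using S\<kappa>[OF g] mg[OF \<kappa> gG U] \<eta>
          by (intro integral_near_of_concentrated[OF reg[OF \<kappa> gG] f b U])
            (auto simp: U_def dist_real_def abs_minus_commute[of "f z"])
        with be \<eta> show ?thesis by (simp add: dist_real_def)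
      qed
      ultimately show "\<forall>\<^sub>F g in F. dist (\<integral>x. f x \<partial>distr \<kappa> ?B (\<phi> g)) (f z) < \<eta>"
        unfolding base eventually_principal by blast
    qed
  qed (rule ret)
  have "limitin (Prob_topology X) (\<lambda>g. distr \<mu> ?B (\<phi> g)) (return ?B z) F"
    using \<mu> by (rule lim) (simp add: S_def)
  moreover have "limitin (Prob_topology X) (\<lambda>g. distr \<nu> ?B (\<phi> g)) (return ?B z) F"
    using \<nu> by (rule lim) (simp add: S_def)
  ultimately show "\<exists>F \<kappa>. F \<noteq> bot \<and> (\<forall>\<^sub>F g in F. g \<in> carrier G) \<and>
      limitin (Prob_topology X) (\<lambda>g. distr \<mu> ?B (\<phi> g)) \<kappa> F \<and>
      limitin (Prob_topology X) (\<lambda>g. distr \<nu> ?B (\<phi> g)) \<kappa> F"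
    using Fnb evG by blast
qed

theorem contractive_imp_boundary:
  assumes "compact_space X" "Hausdorff_space X" "topspace X \<noteq> {}"
    "homeo_action G X \<phi>" "contractive X (carrier G) \<phi>"
  shows "boundary_action G X \<phi>"
proof -
  have "minimal_action G X \<phi>"
    unfolding minimal_action_def using contractive_invariant_closed[OF assms(5)] by blast
  with assms contractive_imp_strongly_proximal[OF assms] show ?thesis
    by (simp add: boundary_action_def)
qed

section \<open>From strong proximality to contraction\<close>

lemma compact_space_finite_neighbourhoods:
  assumes "compact_space X" "\<And>x. x \<in> topspace X \<Longrightarrow> openin X (W x)" "\<And>x. x \<in> topspace X \<Longrightarrow> x \<in> W x"
  obtains Z where "finite Z" "Z \<subseteq> topspace X" "topspace X \<subseteq> (\<Union>z\<in>Z. W z)"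
proof -
  have "\<exists>\<F>. finite \<F> \<and> \<F> \<subseteq> W ` topspace X \<and> topspace X \<subseteq> \<Union>\<F>"
    using assms by (intro compactinD[of X]) (auto simp: compact_space_def)
  then show ?thesis using that by (metis finite_subset_image)
qed

text \<open>By Tychonoff the charges form a compact set, closed in a product of unit intervals
  indexed by all subsets. Each bound on \<open>m (W i)\<close> concerns a single coordinate, so it
  is a closed condition for an arbitrary set \<open>W i\<close>, and the finite intersection
  property applies.\<close>

lemma compact_charge_bounds:
  fixes S :: "'a set" and W :: "'i \<Rightarrow> 'a set"
  assumes fin: "\<And>F. finite F \<Longrightarrow> F \<subseteq> I \<Longrightarrow> \<exists>m. charge S m \<and> (\<forall>i\<in>F. m (W i) \<le> c)"
  obtains m where "charge S m" "\<And>i. i \<in> I \<Longrightarrow> m (W i) \<le> (c::real)"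
proof -
  define P :: "('a set \<Rightarrow> real) set" where "P = PiE UNIV (\<lambda>_. {0..1})"
  have "compactin (product_topology (\<lambda>_. euclideanreal) (UNIV :: 'a set set)) P"
    unfolding P_def compactin_PiE by simp
  then have cP: "compact P" by (simp add: euclidean_product_topology)
  have co: "continuous_on UNIV (\<lambda>m :: 'a set \<Rightarrow> real. m A)" for A
    by (rule continuous_on_product_coordinates)
  have "closed {m :: 'a set \<Rightarrow> real. m UNIV = 1 \<and> m S = 1 \<and> (\<forall>A B. A \<inter> B = {} \<longrightarrow> m (A \<union> B) = m A + m B)}"
    by (intro closed_Collect_conj closed_Collect_all closed_Collect_imp open_Collect_const
        closed_Collect_eq[OF co continuous_on_const]
        closed_Collect_eq[OF co continuous_on_add[OF co co]])
  then have cK: "compact {m. charge S m}"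
  proof -
    assume "closed {m :: 'a set \<Rightarrow> real. m UNIV = 1 \<and> m S = 1 \<and>
      (\<forall>A B. A \<inter> B = {} \<longrightarrow> m (A \<union> B) = m A + m B)}" (is "closed ?C")
    with cP have "compact (P \<inter> ?C)" by (rule compact_Int_closed)
    also have "P \<inter> ?C = {m. charge S m}"
      using charge_le_1[of S] by (auto simp: charge_def P_def)
    finally show ?thesis .
  qed
  have "{m. charge S m} \<inter> (\<Inter>i\<in>I. {m. m (W i) \<le> c}) \<noteq> {}"
  proof (rule compact_imp_fip_image[OF cK])
    show "closed {m. m (W i) \<le> c}" for i
      by (rule closed_Collect_le[OF co continuous_on_const])
    fix F assume "finite F" "F \<subseteq> I"
    from fin[OF this] show "{m. charge S m} \<inter> (\<Inter>i\<in>F. {m. m (W i) \<le> c}) \<noteq> {}"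
      by auto
  qed
  then show ?thesis using that by auto
qed

text \<open>The points whose orbit avoids \<open>U\<close> form a closed invariant set that contains
  no point of \<open>U\<close>, so by minimality it is empty.\<close>

lemma minimal_action_hits:
  assumes ho: "homeo_action G X \<phi>" and mi: "minimal_action G X \<phi>"
    and U: "openin X U" "U \<noteq> {}" and x: "x \<in> topspace X"
  shows "\<exists>h\<in>carrier G. \<phi> h x \<in> U"
proof -
  interpret group G
    using ho group_action.group_hom group_hom.axioms(1) unfolding homeo_action_def by blast
  define S where "S = topspace X - (\<Union>h\<in>carrier G. {x \<in> topspace X. \<phi> h x \<in> U})"
  have "closedin X S"
    unfolding S_def using homeo_action_continuous[OF ho] U(1)
    by (intro closedin_diff openin_Union) (auto intro: openin_continuous_map_preimage)
  moreover have "\<phi> g ` S \<subseteq> S" if g: "g \<in> carrier G" for g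
  proof clarify
    fix y assume y: "y \<in> S"
    then have yX: "y \<in> topspace X" by (simp add: S_def)
    have "\<phi> h (\<phi> g y) \<notin> U" if "h \<in> carrier G" for h
      using y yX m_closed[OF that g] homeo_action_mult[OF ho that g yX] by (auto simp: S_def)
    then show "\<phi> g y \<in> S"
      using homeo_action_closed[OF ho g yX] by (auto simp: S_def)
  qed
  moreover have "S \<noteq> topspace X"
  proof -
    obtain u where u: "u \<in> U" using U by blast
    then have "u \<in> topspace X" using U openin_subset by blast
    then have "u \<notin> S" using u homeo_action_one[OF ho] by (auto simp: S_def intro!: bexI[of _ "\<one>\<^bsub>G\<^esub>"])
    with \<open>u \<in> topspace X\<close> show ?thesis by blast
  qed
  ultimately have "S = {}" using mi unfolding minimal_action_def by blast
  with x show ?thesis by (auto simp: S_def)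
qed

text \<open>Were the action not contractive, compactness of the space of charges would give one charge
  that the whole group keeps away from some \<open>U\<close>; regularized to a measure it contradicts strong
  proximality.\<close>

theorem boundary_imp_contractive:
  assumes bd: "boundary_action G X \<phi>"
  shows "contractive X (carrier G) \<phi>"
proof (rule ccontr)
  have cp: "compact_space X" and H: "Hausdorff_space X" and ne: "topspace X \<noteq> {}"
    and ho: "homeo_action G X \<phi>" and mi: "minimal_action G X \<phi>"
    and sp: "strongly_proximal_action G X \<phi>"
    using bd by (auto simp: boundary_action_def)
  let ?B = "borel_measure_of X"
  have nrm: "normal_space X"
    using cp H by (simp add: compact_Hausdorff_or_regular_imp_normal_space)
  interpret group G
    using ho group_action.group_hom group_hom.axioms(1) unfolding homeo_action_def by blast
  have cont: "continuous_map X X (\<phi> g)" if "g \<in> carrier G" for g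
    using homeo_action_continuous[OF ho that] .
  assume "\<not> contractive X (carrier G) \<phi>"
  then have "\<exists>U e. openin X U \<and> U \<noteq> {} \<and> 0 < e \<and> \<not> (\<exists>F\<subseteq>carrier G. finite F \<and>
      (\<forall>m. charge (topspace X) m \<longrightarrow> (\<exists>g\<in>F. 1 - e \<le> m {x. \<phi> g x \<in> U})))"
    unfolding contractive_def by (simp only: not_all not_imp simp_thms)
  then obtain U and e :: real where U: "openin X U" "U \<noteq> {}" and e: "0 < e"
    and bad: "\<not> (\<exists>F\<subseteq>carrier G. finite F \<and>
      (\<forall>m. charge (topspace X) m \<longrightarrow> (\<exists>g\<in>F. 1 - e \<le> m {x. \<phi> g x \<in> U})))"
    by (elim exE conjE)
  obtain m where m: "charge (topspace X) m" "\<And>g. g \<in> carrier G \<Longrightarrow> m {x. \<phi> g x \<in> U} \<le> 1 - e"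
  proof (rule compact_charge_bounds[of "carrier G" "topspace X" "\<lambda>g. {x. \<phi> g x \<in> U}" "1 - e"])
    fix F assume "finite F" "F \<subseteq> carrier G"
    with bad have "\<not> (\<forall>m. charge (topspace X) m \<longrightarrow> (\<exists>g\<in>F. 1 - e \<le> m {x. \<phi> g x \<in> U}))"
      by metis
    then show "\<exists>m. charge (topspace X) m \<and> (\<forall>i\<in>F. m {x. \<phi> i x \<in> U} \<le> 1 - e)"
      by (meson less_imp_le not_le)
  qed (rule that)
  obtain \<mu> where \<mu>: "\<mu> \<in> regular_probs X" "\<And>U. openin X U \<Longrightarrow> measure \<mu> U \<le> m U"
    using charge_regularization[OF cp H m(1)] by blast
  have small: "measure \<mu> {x \<in> topspace X. \<phi> g x \<in> U} \<le> 1 - e" if g: "g \<in> carrier G" for g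
  proof -
    have "measure \<mu> {x \<in> topspace X. \<phi> g x \<in> U} \<le> m {x \<in> topspace X. \<phi> g x \<in> U}"
      using g U cont by (intro \<mu>(2) openin_continuous_map_preimage)
    also have "\<dots> \<le> m {x. \<phi> g x \<in> U}" by (intro charge_mono[OF m(1)]) auto
    also have "\<dots> \<le> 1 - e" by (rule m(2)[OF g])
    finally show ?thesis .
  qed
  obtain x where x: "x \<in> topspace X" using ne by blast
  \<comment> \<open>The proximal partner of \<open>\<mu>\<close> is a point mass: all its images are
    point masses, so a cluster point of \<open>\<phi> g x\<close> shows where the common limit has
    mass.\<close>
  have ret: "return ?B x \<in> regular_probs X" using H x by (rule regular_probs_return)
  obtain F \<nu> where F: "F \<noteq> bot" "\<forall>\<^sub>F g in F. g \<in> carrier G"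
    and l1: "limitin (Prob_topology X) (\<lambda>g. distr \<mu> ?B (\<phi> g)) \<nu> F"
    and l2: "limitin (Prob_topology X) (\<lambda>g. distr (return ?B x) ?B (\<phi> g)) \<nu> F"
    using sp \<mu>(1) ret unfolding strongly_proximal_action_def proximal_action_def topspace_Prob_topology
    by blast
  \<comment> \<open>A cluster point of the net \<open>\<phi> g x\<close> exists: otherwise finitely
    many sets which the net eventually leaves would cover the space.\<close>
  have "\<exists>z\<in>topspace X. \<forall>W. openin X W \<longrightarrow> z \<in> W \<longrightarrow> \<not> (\<forall>\<^sub>F g in F. \<phi> g x \<notin> W)"
  proof (rule ccontr)
    assume "\<not> ?thesis"
    then obtain W where W: "\<And>z. z \<in> topspace X \<Longrightarrow> openin X (W z) \<and> z \<in> W z \<and> (\<forall>\<^sub>F g in F. \<phi> g x \<notin> W z)"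
      by metis
    obtain Z where Z: "finite Z" "Z \<subseteq> topspace X" "topspace X \<subseteq> (\<Union>z\<in>Z. W z)"
      by (rule compact_space_finite_neighbourhoods[OF cp, of W]) (use W in simp_all)
    have "\<forall>\<^sub>F g in F. \<forall>z\<in>Z. \<phi> g x \<notin> W z"
      using Z W by (intro eventually_ball_finite) auto
    with F(2) have "\<forall>\<^sub>F g in F. False"
    proof eventually_elim
      case (elim g)
      then show ?case using Z homeo_action_closed[OF ho _ x, of g] by blast
    qed
    with F(1) show False by (simp add: trivial_limit_def)
  qed
  then obtain z where z: "z \<in> topspace X"
    and zW: "\<And>W. openin X W \<Longrightarrow> z \<in> W \<Longrightarrow> \<not> (\<forall>\<^sub>F g in F. \<phi> g x \<notin> W)" by blast
  \<comment> \<open>Thus \<open>z\<close> has the neighbourhood \<open>V\<close>, and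
    \<open>\<phi> g y \<in> V\<close> means that \<open>h \<otimes> g\<close> takes \<open>y\<close>
    into \<open>U\<close>. By \<open>small\<close> the images of \<open>\<mu>\<close> never give
    \<open>V\<close>, and hence never the function \<open>f\<close> supported in it, more than
    \<open>1 - e\<close>.\<close>
  obtain h where h: "h \<in> carrier G" "\<phi> h z \<in> U"
    using minimal_action_hits[OF ho mi U z] by blast
  define V where "V = {y \<in> topspace X. \<phi> h y \<in> U}"
  have V: "openin X V" unfolding V_def using h U cont by (intro openin_continuous_map_preimage)
  have zV: "z \<in> V" using z h by (simp add: V_def)
  have "closedin X {z}" using H z by (simp add: closedin_Hausdorff_singleton)
  then obtain f where f: "continuous_map X (top_of_set {0..1::real}) f" "f ` (topspace X - V) \<subseteq> {0}" "f ` {z} \<subseteq> {1}"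
    using Urysohn_lemma[OF nrm, of "topspace X - V" "{z}" 0 1] V zV by (auto simp: disjnt_def)
  have fc: "continuous_map X euclideanreal f" and f01: "\<And>y. y \<in> topspace X \<Longrightarrow> f y \<in> {0..1}"
    using f(1) by (auto simp: continuous_map_in_subtopology)
  have mf: "f \<in> borel_measurable ?B" using fc by (rule continuous_map_real_measurable)
  have t1: "((\<lambda>g. \<integral>y. f y \<partial>distr \<mu> ?B (\<phi> g)) \<longlongrightarrow> (\<integral>y. f y \<partial>\<nu>)) F"
    and t2: "((\<lambda>g. \<integral>y. f y \<partial>distr (return ?B x) ?B (\<phi> g)) \<longlongrightarrow> (\<integral>y. f y \<partial>\<nu>)) F"
    using l1 l2 fc unfolding limitin_Prob_topology by blast+
  have "\<forall>\<^sub>F g in F. (\<integral>y. f y \<partial>distr \<mu> ?B (\<phi> g)) \<le> 1 - e"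
    using F(2)
  proof eventually_elim
    case (elim g)
    interpret P: prob_space \<mu> using \<mu>(1) by (rule regular_probsD)
    note [simp] = regular_probsD(2,3)[OF \<mu>(1)]
    have mg: "\<phi> g \<in> \<mu> \<rightarrow>\<^sub>M ?B"
      using continuous_map_measurable[OF cont[OF elim]] by (simp cong: measurable_cong_sets)
    let ?A = "{y \<in> topspace X. \<phi> (h \<otimes>\<^bsub>G\<^esub> g) y \<in> U}"
    have [simp]: "?A \<inter> topspace X = ?A" by blast
    have mA: "?A \<in> sets \<mu>"
      using openin_sets_borel_measure_of[OF openin_continuous_map_preimage[OF cont U(1)], of "h \<otimes>\<^bsub>G\<^esub> g"] h elim
      by simp
    have "(\<integral>y. f y \<partial>distr \<mu> ?B (\<phi> g)) = (\<integral>y. f (\<phi> g y) \<partial>\<mu>)"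
      using mg mf by (rule integral_distr)
    also have "\<dots> \<le> (\<integral>y. indicat_real ?A y \<partial>\<mu>)"
    proof (rule integral_mono)
      have gX: "\<phi> g y \<in> topspace X" if "y \<in> topspace X" for y
        using homeo_action_closed[OF ho elim that] .
      show "integrable \<mu> (\<lambda>y. f (\<phi> g y))"
        using mg mf f01[OF gX] by (intro P.integrable_const_bound[where B = 1]) auto
      show "integrable \<mu> (indicat_real ?A)"
        using mA by (simp add: integrable_indicator_iff P.emeasure_eq_measure)
      fix y assume "y \<in> space \<mu>"
      then have y: "y \<in> topspace X" by simp
      show "f (\<phi> g y) \<le> indicat_real ?A y"
        using f01[OF gX[OF y]] f(2) gX[OF y] y homeo_action_mult[OF ho h(1) elim y]
        by (auto simp: indicator_def V_def image_subset_iff)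
    qed
    also have "\<dots> = measure \<mu> ?A" using mA by simp
    also have "\<dots> \<le> 1 - e" using h(1) elim by (intro small) auto
    finally show ?case .
  qed
  then have "(\<integral>y. f y \<partial>\<nu>) \<le> 1 - e"
    using t1 F(1) by (intro tendsto_upperbound[of _ _ F])
  \<comment> \<open>A strict bound on the limit passes to the net: eventually
    \<open>f (\<phi> g x) < 1 - e/2\<close>, although \<open>\<phi> g x\<close> clusters at
    \<open>z\<close>, where \<open>f\<close> is 1.\<close>
  then have "(\<integral>y. f y \<partial>\<nu>) < 1 - e/2" using e by simp
  with t2 have "\<forall>\<^sub>F g in F. (\<integral>y. f y \<partial>distr (return ?B x) ?B (\<phi> g)) < 1 - e/2"
    by (rule order_tendstoD)
  with F(2) have "\<forall>\<^sub>F g in F. \<phi> g x \<notin> {y \<in> topspace X. f y \<in> {1 - e/2 <..}}"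
  proof eventually_elim
    case (elim g)
    have mg: "\<phi> g \<in> return ?B x \<rightarrow>\<^sub>M ?B"
      using continuous_map_measurable[OF cont[OF elim(1)]] by (simp cong: measurable_cong_sets)
    have "(\<integral>y. f y \<partial>distr (return ?B x) ?B (\<phi> g)) = (\<integral>y. f (\<phi> g y) \<partial>return ?B x)"
      using mg mf by (rule integral_distr)
    also have "\<dots> = f (\<phi> g x)"
      using x mg mf by (intro integral_return) (auto simp: space_borel_measure_of intro: measurable_compose)
    finally show ?case using elim by auto
  qed
  moreover have "openin X {y \<in> topspace X. f y \<in> {1 - e/2 <..}}"
    using fc by (rule openin_continuous_map_preimage) simp
  moreover have "z \<in> {y \<in> topspace X. f y \<in> {1 - e/2 <..}}"
    using z f(3) e by auto
  ultimately show False using zW by blast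
qed

text \<open>Each condition can be reached by passing to a smaller open set and then persists, so
  shrinking once per index achieves all of them. This is how one target set is adapted to finitely
  many group elements.\<close>

lemma finite_shrink_open:
  assumes K: "finite K" and U: "openin X U" "U \<noteq> {}"
    and dense: "\<And>k V. k \<in> K \<Longrightarrow> openin X V \<Longrightarrow> V \<noteq> {} \<Longrightarrow> \<exists>V'\<subseteq>V. openin X V' \<and> V' \<noteq> {} \<and> D k V'"
    and hereditary: "\<And>k V V'. D k V \<Longrightarrow> V' \<subseteq> V \<Longrightarrow> D k V'"
  shows "\<exists>V\<subseteq>U. openin X V \<and> V \<noteq> {} \<and> (\<forall>k\<in>K. D k V)"
  using K dense
proof (induction K)
  case empty
  then show ?case using U by blast
next
  case (insert k K)
  then obtain V where V: "V \<subseteq> U" "openin X V" "V \<noteq> {}" "\<forall>k\<in>K. D k V"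
    by (metis insertCI)
  obtain V' where V': "V' \<subseteq> V" "openin X V'" "V' \<noteq> {}" "D k V'"
    using insert.prems[of k V] V by blast
  have "\<forall>j\<in>K. D j V'" using V(4) V'(1) hereditary by blast
  with V V' show ?case by (intro exI[of _ V']) auto
qed

lemma contractive_reindex:
  assumes "contractive X N \<theta>" "\<And>n. n \<in> N \<Longrightarrow> f n \<in> N'" "\<And>n. n \<in> N \<Longrightarrow> \<theta>' (f n) = \<theta> n"
  shows "contractive X N' \<theta>'"
  unfolding contractive_def
proof (intro allI impI)
  fix U and e :: real assume U: "openin X U" "U \<noteq> {}" "0 < e"
  obtain F where F: "F \<subseteq> N" "finite F"
    "\<forall>m. charge (topspace X) m \<longrightarrow> (\<exists>g\<in>F. 1 - e \<le> m {x. \<theta> g x \<in> U})"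
    using assms(1)[unfolded contractive_def, rule_format, OF U] by blast
  show "\<exists>F\<subseteq>N'. finite F \<and> (\<forall>m. charge (topspace X) m \<longrightarrow> (\<exists>g\<in>F. 1 - e \<le> m {x. \<theta>' g x \<in> U}))"
  proof (intro exI[of _ "f ` F"] conjI allI impI)
    show "f ` F \<subseteq> N'" using F(1) assms(2) by blast
    show "finite (f ` F)" using F(2) by simp
    fix m assume "charge (topspace X) m"
    then obtain g where g: "g \<in> F" "1 - e \<le> m {x. \<theta> g x \<in> U}" using F(3) by blast
    moreover have "\<theta>' (f g) = \<theta> g" using g F(1) by (intro assms(3)) blast
    ultimately show "\<exists>g\<in>f ` F. 1 - e \<le> m {x. \<theta>' g x \<in> U}"
      by (intro bexI[of _ "f g"]) auto
  qed
qed

section \<open>Finite index subgroups of a commensurated subgroup\<close>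

text \<open>Contraction stands for minimality and strong proximality, from which
  \<open>boundary_imp_contractive\<close> derives it, because it is the form that descends to
  subgroups.\<close>

locale commensurated_boundary = group G for G (structure) +
  fixes L :: "'a set" and X :: "'x topology" and \<phi> :: "'a \<Rightarrow> 'x \<Rightarrow> 'x"
  assumes subL: "subgroup L G" and comm: "commensurated G L"
    and cp: "compact_space X" and HX: "Hausdorff_space X" and ne: "topspace X \<noteq> {}"
    and ho: "homeo_action (G\<lparr>carrier := L\<rparr>) X \<phi>" and con: "contractive X L \<phi>"
begin

lemma L_carrier: "l \<in> L \<Longrightarrow> l \<in> carrier G"
  using subL by (rule subgroup.mem_carrier)

lemma L_mult: "l \<in> L \<Longrightarrow> k \<in> L \<Longrightarrow> l \<otimes> k \<in> L"
  using subL by (rule subgroup.m_closed)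

lemma L_inv: "l \<in> L \<Longrightarrow> inv l \<in> L"
  using subL by (rule subgroup.m_inv_closed)

lemma L_one: "\<one> \<in> L"
  using subL by (rule subgroup.one_closed)

lemma act_cont: "l \<in> L \<Longrightarrow> continuous_map X X (\<phi> l)"
  using homeo_action_continuous[OF ho] by simp

lemma act_closed: "l \<in> L \<Longrightarrow> x \<in> topspace X \<Longrightarrow> \<phi> l x \<in> topspace X"
  using homeo_action_closed[OF ho] by simp

lemma act_mult: "l \<in> L \<Longrightarrow> k \<in> L \<Longrightarrow> x \<in> topspace X \<Longrightarrow> \<phi> (l \<otimes> k) x = \<phi> l (\<phi> k x)"
  using homeo_action_mult[OF ho] by simp

lemma act_one: "x \<in> topspace X \<Longrightarrow> \<phi> \<one> x = x"
  using homeo_action_one[OF ho] by simp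

lemma act_open: "l \<in> L \<Longrightarrow> openin X U \<Longrightarrow> openin X {x \<in> topspace X. \<phi> l x \<in> U}"
  using act_cont openin_continuous_map_preimage by blast

section \<open>Commensuration and finite index\<close>

lemma mult_inv_cancel:
  "\<lbrakk>g \<in> carrier G; x \<in> carrier G\<rbrakk> \<Longrightarrow> g \<otimes> (inv g \<otimes> x) = x"
  by (simp flip: m_assoc)

lemma inv_mult_cancel:
  "\<lbrakk>g \<in> carrier G; x \<in> carrier G\<rbrakk> \<Longrightarrow> inv g \<otimes> (g \<otimes> x) = x"
  by (simp flip: m_assoc)

text \<open>The intersection of \<open>L\<close> with the conjugates \<open>inv s <# L #> s\<close>:
  its elements \<open>n\<close> act on \<open>X\<close> through every
  \<open>s \<otimes> n \<otimes> inv s\<close>. A basic open set of a product restricts finitely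
  many coordinates, so finite \<open>S\<close> are the ones of interest.\<close>

definition core :: "'a set \<Rightarrow> 'a set" where
  "core S = {n \<in> L. \<forall>s\<in>S. s \<otimes> n \<otimes> inv s \<in> L}"

lemma core_L: "n \<in> core S \<Longrightarrow> n \<in> L"
  by (simp add: core_def)

lemma core_conj: "n \<in> core S \<Longrightarrow> s \<in> S \<Longrightarrow> s \<otimes> n \<otimes> inv s \<in> L"
  by (simp add: core_def)

lemma conj_mult:
  "\<lbrakk>s \<in> carrier G; m \<in> carrier G; n \<in> carrier G\<rbrakk> \<Longrightarrow>
    s \<otimes> (m \<otimes> n) \<otimes> inv s = (s \<otimes> m \<otimes> inv s) \<otimes> (s \<otimes> n \<otimes> inv s)"
  by (simp add: m_assoc mult_inv_cancel inv_mult_cancel)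

lemma conj_inv:
  "\<lbrakk>s \<in> carrier G; n \<in> carrier G\<rbrakk> \<Longrightarrow> s \<otimes> inv n \<otimes> inv s = inv (s \<otimes> n \<otimes> inv s)"
  by (simp add: m_assoc inv_mult_group)

lemma core_one: "S \<subseteq> carrier G \<Longrightarrow> \<one> \<in> core S"
  by (auto simp: core_def L_one subset_iff)

lemma core_mult: "S \<subseteq> carrier G \<Longrightarrow> m \<in> core S \<Longrightarrow> n \<in> core S \<Longrightarrow> m \<otimes> n \<in> core S"
  unfolding core_def by (auto simp: L_mult conj_mult L_carrier subset_iff)

lemma core_inv: "S \<subseteq> carrier G \<Longrightarrow> n \<in> core S \<Longrightarrow> inv n \<in> core S"
  unfolding core_def by (auto simp: L_inv conj_inv L_carrier subset_iff)

text \<open>\<open>l \<otimes> inv t \<in> N\<close> says that \<open>l\<close> lies in the right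
  coset of \<open>t\<close>. The set \<open>T\<close> of representatives is explicit because later
  arguments run through it.\<close>

definition finite_index :: "'a set \<Rightarrow> bool" where
  "finite_index N \<longleftrightarrow> (\<exists>T\<subseteq>L. finite T \<and> (\<forall>l\<in>L. \<exists>t\<in>T. l \<otimes> inv t \<in> N))"

lemma finite_index_core_singleton:
  assumes g: "g \<in> carrier G"
  shows "finite_index (core {g})"
proof -
  \<comment> \<open>The conjugate that cuts out \<open>core {g}\<close> is the one by
    \<open>inv g\<close>, so commensuration is used at \<open>inv g\<close>.\<close>
  have "core {g} = L \<inter> (inv g <# L #> inv (inv g))"
  proof (intro equalityI subsetI)
    fix n assume n: "n \<in> core {g}"
    then have nc: "n \<in> carrier G" by (simp add: core_L L_carrier)
    have "n = inv g \<otimes> (g \<otimes> n \<otimes> inv g) \<otimes> inv (inv g)"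
      using g nc by (simp add: m_assoc mult_inv_cancel inv_mult_cancel)
    with n show "n \<in> L \<inter> (inv g <# L #> inv (inv g))"
      using core_conj[OF n, of g] by (auto simp: core_L l_coset_def r_coset_def)
  next
    fix n assume "n \<in> L \<inter> (inv g <# L #> inv (inv g))"
    then obtain l where l: "n \<in> L" "l \<in> L" "n = inv g \<otimes> l \<otimes> inv (inv g)"
      by (auto simp: l_coset_def r_coset_def)
    then have "g \<otimes> n \<otimes> inv g = l"
      using g L_carrier[OF l(2)] by (simp add: m_assoc mult_inv_cancel inv_mult_cancel)
    with l show "n \<in> core {g}" by (simp add: core_def)
  qed
  then have fin: "finite (rcosets\<^bsub>G\<lparr>carrier := L\<rparr>\<^esub> (core {g}))"
    using bspec[OF comm[unfolded commensurated_def], of "inv g"] g by simp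
  define c where "c l = (\<lambda>k. k \<otimes> l) ` core {g}" for l
  have "rcosets\<^bsub>G\<lparr>carrier := L\<rparr>\<^esub> (core {g}) = c ` L"
    by (auto simp: RCOSETS_def r_coset_def c_def)
  with fin have "finite (c ` L)" by simp
  then obtain T where T: "T \<subseteq> L" "finite T" "c ` L = c ` T"
    using finite_subset_image[of "c ` L" c L] by auto
  have "\<exists>t\<in>T. l \<otimes> inv t \<in> core {g}" if l: "l \<in> L" for l
  proof -
    obtain t where t: "t \<in> T" "c l = c t" using T(3) l by blast
    have "\<one> \<otimes> l \<in> c l" unfolding c_def using core_one[of "{g}"] g by blast
    then obtain k where k: "k \<in> core {g}" "l = k \<otimes> t"
      using t(2) l L_carrier unfolding c_def by auto
    have "l \<otimes> inv t = k"
      using k t(1) T(1) L_carrier core_L by (auto simp: m_assoc subset_iff)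
    then show ?thesis using t(1) k(1) by (intro bexI[of _ t]) simp_all
  qed
  then show ?thesis unfolding finite_index_def using T(1,2) by (intro exI[of _ T]) simp
qed

text \<open>A non-empty intersection of a coset of \<open>core S\<close> with a coset of
  \<open>core S'\<close> is a coset of \<open>core (S \<union> S')\<close>. One representative is
  chosen in each.\<close>

lemma finite_index_core_Un:
  assumes "S \<subseteq> carrier G" "S' \<subseteq> carrier G" "finite_index (core S)" "finite_index (core S')"
  shows "finite_index (core (S \<union> S'))"
proof -
  obtain T T' where T: "T \<subseteq> L" "finite T" "\<And>l. l \<in> L \<Longrightarrow> \<exists>t\<in>T. l \<otimes> inv t \<in> core S"
    and T': "T' \<subseteq> L" "finite T'" "\<And>l. l \<in> L \<Longrightarrow> \<exists>t\<in>T'. l \<otimes> inv t \<in> core S'"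
    using assms(3,4) unfolding finite_index_def by blast
  define P where "P p l \<longleftrightarrow> l \<in> L \<and> l \<otimes> inv (fst p) \<in> core S \<and> l \<otimes> inv (snd p) \<in> core S'" for p l
  define R where "R = (\<lambda>p. SOME l. P p l) ` {p \<in> T \<times> T'. \<exists>l. P p l}"
  have div: "l \<otimes> inv l' \<in> core S"
    if "S \<subseteq> carrier G" "t \<in> L" "l \<in> L" "l' \<in> L" "l \<otimes> inv t \<in> core S" "l' \<otimes> inv t \<in> core S" for S t l l'
  proof -
    have "(l \<otimes> inv t) \<otimes> inv (l' \<otimes> inv t) \<in> core S"
      using that by (blast intro: core_mult core_inv)
    moreover have "(l \<otimes> inv t) \<otimes> inv (l' \<otimes> inv t) = l \<otimes> inv l'"
      using that by (simp add: L_carrier inv_mult_group m_assoc mult_inv_cancel inv_mult_cancel)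
    ultimately show ?thesis by simp
  qed
  have "R \<subseteq> L"
  proof
    fix r assume "r \<in> R"
    then obtain p where "r = (SOME l. P p l)" "\<exists>l. P p l" by (auto simp: R_def)
    then have "P p r" using someI_ex[of "P p"] by simp
    then show "r \<in> L" by (simp add: P_def)
  qed
  moreover have "finite R" unfolding R_def using T(2) T'(2) by simp
  moreover have "\<exists>t\<in>R. l \<otimes> inv t \<in> core (S \<union> S')" if l: "l \<in> L" for l
  proof -
    obtain t t' where t: "t \<in> T" "l \<otimes> inv t \<in> core S" "t' \<in> T'" "l \<otimes> inv t' \<in> core S'"
      using T(3)[OF l] T'(3)[OF l] by blast
    define l' where "l' = (SOME l. P (t, t') l)"
    have Pl: "P (t, t') l" using t l by (simp add: P_def)
    then have l': "P (t, t') l'" unfolding l'_def by (rule someI)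
    then have "l' \<in> L" "l' \<otimes> inv t \<in> core S" "l' \<otimes> inv t' \<in> core S'" by (auto simp: P_def)
    then have "l \<otimes> inv l' \<in> core S" "l \<otimes> inv l' \<in> core S'"
      using div[of S t l l'] div[of S' t' l l'] t l T(1) T'(1) assms(1,2) by auto
    then have "l \<otimes> inv l' \<in> core (S \<union> S')" by (auto simp: core_def)
    moreover have "l' \<in> R" unfolding R_def l'_def using Pl t by (intro imageI) auto
    ultimately show ?thesis by blast
  qed
  ultimately show ?thesis unfolding finite_index_def by blast
qed

lemma finite_index_core:
  assumes "finite S" "S \<subseteq> carrier G"
  shows "finite_index (core S)"
  using assms
proof (induction S)
  case empty
  have "core {} = L" by (simp add: core_def)
  then show ?case
    unfolding finite_index_def using L_one L_carrier by (intro exI[of _ "{\<one>}"]) auto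
next
  case (insert s S)
  then show ?case
    using finite_index_core_Un[of "{s}" S] finite_index_core_singleton[of s] by simp
qed

text \<open>The translates of the closed set \<open>Z\<close> of points that never enter \<open>U\<close> are finite in number, and
  the set of those containing a given point is constant on some open set, into which any two points
  can be moved simultaneously.\<close>

lemma core_hits:
  assumes S: "finite S" "S \<subseteq> carrier G" and U: "openin X U" "U \<noteq> {}" and y: "y \<in> topspace X"
  shows "\<exists>n\<in>core S. \<phi> n y \<in> U"
proof -
  let ?N = "core S"
  obtain T where T: "T \<subseteq> L" "finite T" "\<And>l. l \<in> L \<Longrightarrow> \<exists>t\<in>T. l \<otimes> inv t \<in> ?N"
    using finite_index_core[OF S] unfolding finite_index_def by blast
  define Z where "Z = topspace X - (\<Union>n\<in>?N. {x \<in> topspace X. \<phi> n x \<in> U})"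
  have Zc: "closedin X Z"
    unfolding Z_def using U(1) by (intro closedin_diff openin_Union) (auto intro: act_open core_L)
  have Zi: "\<phi> n x \<in> Z" if n: "n \<in> ?N" and x: "x \<in> Z" for n x
  proof -
    have xX: "x \<in> topspace X" using x by (simp add: Z_def)
    have "\<phi> k (\<phi> n x) \<notin> U" if "k \<in> ?N" for k
      using x xX core_mult[OF S(2) that n] act_mult[OF core_L[OF that] core_L[OF n] xX]
      by (auto simp: Z_def)
    then show ?thesis using act_closed[OF core_L[OF n] xX] by (auto simp: Z_def)
  qed
  have Zn: "\<phi> n x \<in> Z \<longleftrightarrow> x \<in> Z" if n: "n \<in> ?N" and x: "x \<in> topspace X" for n x
  proof
    assume "\<phi> n x \<in> Z"
    then have "\<phi> (inv n) (\<phi> n x) \<in> Z" by (rule Zi[OF core_inv[OF S(2) n]])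
    then show "x \<in> Z"
      using act_mult[OF L_inv[OF core_L[OF n]] core_L[OF n] x] act_one[OF x] L_carrier[OF core_L[OF n]]
      by simp
  qed (rule Zi[OF n])
  define c where "c x = {t \<in> T. \<phi> t x \<in> Z}" for x
  have c_fin: "finite (c x)" for x using T(2) by (simp add: c_def)
  \<comment> \<open>Every \<open>l \<in> L\<close> differs from some \<open>t \<in> T\<close> by an
    element of the core on the left, which preserves \<open>Z\<close>. So the finite set
    \<open>c x\<close> decides for all of \<open>L\<close>.\<close>
  have c_L: "\<phi> l x \<in> Z \<longleftrightarrow> \<phi> l x' \<in> Z"
    if cc: "c x = c x'" and l: "l \<in> L" and x: "x \<in> topspace X" "x' \<in> topspace X" for x x' l
  proof -
    obtain t where t: "t \<in> T" "l \<otimes> inv t \<in> ?N" using T(3)[OF l] by blast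
    have tL: "t \<in> L" using t T by blast
    have eq: "\<phi> l z = \<phi> (l \<otimes> inv t) (\<phi> t z)" if "z \<in> topspace X" for z
      using act_mult[OF core_L[OF t(2)] tL that] l tL L_carrier by (simp add: m_assoc)
    have "\<phi> l z \<in> Z \<longleftrightarrow> t \<in> c z" if "z \<in> topspace X" for z
      using Zn[OF t(2) act_closed[OF tL that]] t(1) by (simp add: eq[OF that] c_def)
    with cc x show ?thesis by simp
  qed
  \<comment> \<open>\<open>z\<close> lies in the fewest translates. On \<open>W\<close>, which
    avoids the closed translates that miss \<open>z\<close>, the set \<open>c\<close> can only
    shrink, so by minimality of the cardinality it is constant.\<close>
  obtain z where z: "z \<in> topspace X" "\<And>x. x \<in> topspace X \<Longrightarrow> card (c z) \<le> card (c x)"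
    using ne arg_min_natI[of "\<lambda>x. x \<in> topspace X" _ "\<lambda>x. card (c x)"]
      arg_min_nat_le[of "\<lambda>x. x \<in> topspace X" _ "\<lambda>x. card (c x)"] by (metis ex_in_conv)
  define W where "W = topspace X - (\<Union>t\<in>T - c z. {x \<in> topspace X. \<phi> t x \<in> Z})"
  have Wo: "openin X W"
    unfolding W_def using T Zc act_cont
    by (intro openin_diff closedin_Union) (auto intro: closedin_continuous_map_preimage)
  have zW: "z \<in> W" using z(1) by (auto simp: W_def c_def)
  have cW: "c x = c z" if "x \<in> W" for x
  proof -
    have "c x \<subseteq> c z" using that by (auto simp: W_def c_def)
    then show ?thesis using z(2)[of x] that c_fin card_seteq[of "c z" "c x"] by (auto simp: W_def)
  qed
  \<comment> \<open>Once both points are in \<open>W\<close>, they enter \<open>Z\<close> under the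
    same elements of \<open>L\<close>; the element \<open>inv g\<close>, which moves them back, is
    one of these.\<close>
  have iff: "x \<in> Z \<longleftrightarrow> x' \<in> Z" if x: "x \<in> topspace X" "x' \<in> topspace X" for x x'
  proof -
    obtain g where g: "g \<in> L" "\<phi> g x \<in> W" "\<phi> g x' \<in> W"
      using contractive_pair[OF con Wo _ x] zW by blast
    have "\<phi> (inv g) (\<phi> g z) = z" if "z \<in> topspace X" for z
      using act_mult[OF L_inv[OF g(1)] g(1) that] act_one[OF that] L_carrier[OF g(1)] by simp
    moreover have "\<phi> (inv g) (\<phi> g x) \<in> Z \<longleftrightarrow> \<phi> (inv g) (\<phi> g x') \<in> Z"
      using cW[OF g(2)] cW[OF g(3)] x g by (intro c_L L_inv act_closed) auto
    ultimately show ?thesis using x by simp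
  qed
  obtain u where u: "u \<in> U" using U by blast
  then have "u \<in> topspace X" using U openin_subset by blast
  moreover from this u have "u \<notin> Z" using core_one[OF S(2)] act_one by (force simp: Z_def)
  ultimately have "y \<notin> Z" using iff y by blast
  then show ?thesis using y by (auto simp: Z_def)
qed

text \<open>Contraction by \<open>L\<close> reaches an auxiliary \<open>V\<close>, and a coset
  representative \<open>t\<close> then corrects the contracting \<open>l\<close> to an element of
  the core. \<open>V\<close> is chosen so small that after each of the finitely many
  \<open>t\<close> some core element carries it into \<open>U\<close>.\<close>

lemma contractive_core:
  assumes S: "finite S" "S \<subseteq> carrier G"
  shows "contractive X (core S) \<phi>"
  unfolding contractive_def
proof (intro allI impI)
  let ?N = "core S"
  obtain T where T: "T \<subseteq> L" "finite T" "\<And>l. l \<in> L \<Longrightarrow> \<exists>t\<in>T. l \<otimes> inv t \<in> ?N"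
    using finite_index_core[OF S] unfolding finite_index_def by blast
  fix U and e :: real assume U: "openin X U" "U \<noteq> {}" and e: "0 < e"
  have "\<exists>V\<subseteq>topspace X. openin X V \<and> V \<noteq> {} \<and> (\<forall>t\<in>T. \<exists>h\<in>?N. \<forall>y\<in>V. \<phi> h (\<phi> t y) \<in> U)"
  proof (rule finite_shrink_open[OF T(2) openin_topspace ne])
    fix t V assume t: "t \<in> T" and V: "openin X V" "V \<noteq> {}"
    have tL: "t \<in> L" using t T by blast
    obtain v where v: "v \<in> V" "v \<in> topspace X" using V openin_subset by blast
    obtain h where h: "h \<in> ?N" "\<phi> h (\<phi> t v) \<in> U"
      using core_hits[OF S U act_closed[OF tL v(2)]] by blast
    let ?V = "V \<inter> {x \<in> topspace X. \<phi> t x \<in> {x \<in> topspace X. \<phi> h x \<in> U}}"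
    have "openin X ?V"
      using V(1) U(1) core_L[OF h(1)] tL by (intro openin_Int act_open)
    moreover have "v \<in> ?V" using v h act_closed[OF tL v(2)] by simp
    ultimately show "\<exists>V'\<subseteq>V. openin X V' \<and> V' \<noteq> {} \<and> (\<exists>h\<in>?N. \<forall>y\<in>V'. \<phi> h (\<phi> t y) \<in> U)"
      using h by (intro exI[of _ ?V]) auto
  qed blast
  then obtain V h where V: "openin X V" "V \<noteq> {}"
    and h: "\<And>t. t \<in> T \<Longrightarrow> h t \<in> ?N" "\<And>t y. t \<in> T \<Longrightarrow> y \<in> V \<Longrightarrow> \<phi> (h t) (\<phi> t y) \<in> U"
    by metis
  obtain F where F: "F \<subseteq> L" "finite F"
    "\<And>m. charge (topspace X) m \<Longrightarrow> \<exists>g\<in>F. 1 - e \<le> m {x. \<phi> g x \<in> V}"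
    using con[unfolded contractive_def, rule_format, OF V e] by blast
  \<comment> \<open>The representative is taken for \<open>inv l\<close>, because the inverse of
    \<open>inv l \<otimes> inv t\<close> is \<open>t \<otimes> l\<close>, where \<open>t\<close>
    acts after \<open>l\<close>.\<close>
  have "\<forall>l\<in>F. \<exists>t\<in>T. inv l \<otimes> inv t \<in> ?N" using F(1) T(3) L_inv by blast
  then obtain t where t: "\<And>l. l \<in> F \<Longrightarrow> t l \<in> T" "\<And>l. l \<in> F \<Longrightarrow> inv l \<otimes> inv (t l) \<in> ?N" by metis
  define k where "k l = h (t l) \<otimes> (t l \<otimes> l)" for l
  have tl: "t l \<otimes> l \<in> ?N" if "l \<in> F" for l
  proof -
    have "inv (inv l \<otimes> inv (t l)) \<in> ?N" using t(2)[OF that] by (rule core_inv[OF S(2)])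
    moreover have "l \<in> carrier G" "t l \<in> carrier G"
      using that F(1) t(1) T(1) L_carrier by auto
    ultimately show ?thesis by (simp add: inv_mult_group)
  qed
  have k: "k l \<in> ?N" if "l \<in> F" for l
    unfolding k_def using core_mult[OF S(2) h(1)[OF t(1)[OF that]] tl[OF that]] .
  have kU: "\<phi> (k l) x \<in> U" if l: "l \<in> F" and x: "x \<in> topspace X" "\<phi> l x \<in> V" for l x
  proof -
    have lL: "l \<in> L" "t l \<in> L" using l F(1) t(1) T(1) by auto
    have "\<phi> (k l) x = \<phi> (h (t l)) (\<phi> (t l) (\<phi> l x))"
      unfolding k_def using lL x h(1)[OF t(1)[OF l]] core_L
      by (simp add: act_mult L_mult)
    with h(2)[OF t(1)[OF l] x(2)] show ?thesis by simp
  qed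
  show "\<exists>F\<subseteq>?N. finite F \<and> (\<forall>m. charge (topspace X) m \<longrightarrow> (\<exists>g\<in>F. 1 - e \<le> m {x. \<phi> g x \<in> U}))"
  proof (intro exI[of _ "k ` F"] conjI allI impI)
    show "k ` F \<subseteq> ?N" using k by blast
    show "finite (k ` F)" using F(2) by simp
    fix m assume m: "charge (topspace X) m"
    then obtain l where l: "l \<in> F" "1 - e \<le> m {x. \<phi> l x \<in> V}" using F(3) by blast
    have "m {x. \<phi> l x \<in> V} \<le> m {x. \<phi> (k l) x \<in> U}"
      using kU[OF l(1)] by (intro charge_mono_on[OF m]) auto
    with l show "\<exists>g\<in>k ` F. 1 - e \<le> m {x. \<phi> g x \<in> U}" by (intro bexI[of _ "k l"]) auto
  qed
qed

text \<open>The element \<open>inv g \<otimes> k \<otimes> g\<close> undoes the conjugation, and it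
  lies in \<open>core S\<close> as soon as \<open>k\<close> is in the core of \<open>inv g\<close>
  and of all \<open>s \<otimes> inv g\<close>. This reduces the claim to the unconjugated
  action.\<close>

lemma contractive_conj:
  assumes S: "finite S" "S \<subseteq> carrier G" and g: "g \<in> carrier G"
  shows "contractive X (core S) (\<lambda>n. \<phi> (g \<otimes> n \<otimes> inv g))"
proof (rule contractive_reindex[where f = "\<lambda>k. inv g \<otimes> k \<otimes> g"])
  let ?S = "insert (inv g) ((\<lambda>s. s \<otimes> inv g) ` S)"
  show "contractive X (core ?S) \<phi>" using S g by (intro contractive_core) auto
  fix k assume k: "k \<in> core ?S"
  then have kc: "k \<in> carrier G" by (simp add: core_L L_carrier)
  have "inv g \<otimes> k \<otimes> g \<in> L" using core_conj[OF k, of "inv g"] g by simp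
  moreover have "s \<otimes> (inv g \<otimes> k \<otimes> g) \<otimes> inv s \<in> L" if "s \<in> S" for s
  proof -
    have "s \<in> carrier G" using that S by blast
    then have "s \<otimes> (inv g \<otimes> k \<otimes> g) \<otimes> inv s = (s \<otimes> inv g) \<otimes> k \<otimes> inv (s \<otimes> inv g)"
      using g kc by (simp add: inv_mult_group m_assoc)
    then show ?thesis using core_conj[OF k, of "s \<otimes> inv g"] that by simp
  qed
  ultimately show "inv g \<otimes> k \<otimes> g \<in> core S" by (simp add: core_def)
  show "\<phi> (g \<otimes> (inv g \<otimes> k \<otimes> g) \<otimes> inv g) = \<phi> k"
    using g kc by (simp add: m_assoc mult_inv_cancel inv_mult_cancel)
qed

text \<open>By minimality finitely many \<open>k \<in> core S\<close> move every point to where \<open>f\<^sub>1 \<in> P\<close> and \<open>f\<^sub>2 \<in> Q\<close>,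
  for disjoint \<open>P\<close> and \<open>Q\<close>; but some open set meets for no such \<open>k\<close> both the preimage of \<open>P\<close> and
  that of \<open>Q\<close>, and any two points can be moved into it.\<close>

lemma equivariant_maps_unique:
  assumes S: "finite S" "S \<subseteq> carrier G" "g \<in> S"
    and f1: "continuous_map X X f1" "\<And>n x. n \<in> core S \<Longrightarrow> x \<in> topspace X \<Longrightarrow> f1 (\<phi> n x) = \<phi> (g \<otimes> n \<otimes> inv g) (f1 x)"
    and f2: "continuous_map X X f2" "\<And>n x. n \<in> core S \<Longrightarrow> x \<in> topspace X \<Longrightarrow> f2 (\<phi> n x) = \<phi> (g \<otimes> n \<otimes> inv g) (f2 x)"
    and x: "x \<in> topspace X"
  shows "f1 x = f2 x"
proof (rule ccontr)
  let ?N = "core S" and ?\<theta> = "\<lambda>n. \<phi> (g \<otimes> n \<otimes> inv g)"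
  have g: "g \<in> carrier G" using S by blast
  assume "f1 x \<noteq> f2 x"
  moreover have f1X: "f1 y \<in> topspace X" and f2X: "f2 y \<in> topspace X" if "y \<in> topspace X" for y
    using continuous_map_image_subset_topspace[OF f1(1)] continuous_map_image_subset_topspace[OF f2(1)] that
    by auto
  ultimately obtain P Q where PQ: "openin X P" "openin X Q" "f1 x \<in> P" "f2 x \<in> Q" "disjnt P Q"
    using HX x unfolding Hausdorff_space_def by metis
  define W where "W = {y \<in> topspace X. f1 y \<in> P} \<inter> {y \<in> topspace X. f2 y \<in> Q}"
  have W: "openin X W"
    unfolding W_def using PQ f1(1) f2(1) by (intro openin_Int openin_continuous_map_preimage)
  have xW: "x \<in> W" using x PQ by (simp add: W_def)
  have "\<forall>y\<in>topspace X. \<exists>n\<in>?N. \<phi> n y \<in> W"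
    using core_hits[OF S(1,2) W] xW by blast
  then obtain k where k: "\<And>y. y \<in> topspace X \<Longrightarrow> k y \<in> ?N" "\<And>y. y \<in> topspace X \<Longrightarrow> \<phi> (k y) y \<in> W"
    by metis
  obtain Z where Z: "finite Z" "Z \<subseteq> topspace X" "topspace X \<subseteq> (\<Union>z\<in>Z. {y \<in> topspace X. \<phi> (k z) y \<in> W})"
    by (rule compact_space_finite_neighbourhoods[OF cp, of "\<lambda>z. {y \<in> topspace X. \<phi> (k z) y \<in> W}"])
      (use k W in \<open>auto intro!: act_open core_L\<close>)
  have \<theta>o: "openin X {y \<in> topspace X. ?\<theta> n y \<in> P}" if "n \<in> ?N" for n
    using act_open[OF core_conj[OF that S(3)] PQ(1)] .
  have "\<exists>U\<subseteq>topspace X. openin X U \<and> U \<noteq> {} \<and>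
      (\<forall>z\<in>Z. \<not> ((\<exists>u\<in>U. ?\<theta> (k z) u \<in> P) \<and> (\<exists>u\<in>U. ?\<theta> (k z) u \<in> Q)))"
  proof (rule finite_shrink_open[OF Z(1) openin_topspace ne])
    fix z V assume z: "z \<in> Z" and V: "openin X V" "V \<noteq> {}"
    have kz: "k z \<in> ?N" using k(1) z Z(2) by blast
    let ?V = "V \<inter> {y \<in> topspace X. ?\<theta> (k z) y \<in> P}"
    show "\<exists>V'\<subseteq>V. openin X V' \<and> V' \<noteq> {} \<and>
        \<not> ((\<exists>u\<in>V'. ?\<theta> (k z) u \<in> P) \<and> (\<exists>u\<in>V'. ?\<theta> (k z) u \<in> Q))"
    \<comment> \<open>Either \<open>V\<close> already misses the preimage of \<open>P\<close>, or it
      can be cut down to that preimage, which misses the one of \<open>Q\<close>.\<close>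
    proof (cases "?V = {}")
      case True
      then show ?thesis using V openin_subset[OF V(1)] by (intro exI[of _ V]) blast
    next
      case False
      moreover have "openin X ?V" using V(1) \<theta>o[OF kz] by (rule openin_Int)
      moreover have "\<not> (\<exists>u\<in>?V. ?\<theta> (k z) u \<in> Q)" using PQ(5) by (auto simp: disjnt_iff)
      ultimately show ?thesis by (intro exI[of _ ?V]) blast
    qed
  qed blast
  then obtain U where U: "openin X U" "U \<noteq> {}"
    and UPQ: "\<And>z. z \<in> Z \<Longrightarrow> \<not> ((\<exists>u\<in>U. ?\<theta> (k z) u \<in> P) \<and> (\<exists>u\<in>U. ?\<theta> (k z) u \<in> Q))" by blast
  \<comment> \<open>By equivariance the two points moved into \<open>U\<close> are the images of
    \<open>\<phi> n x\<close> under \<open>f1\<close> and \<open>f2\<close>. Some \<open>k z\<close>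
    takes \<open>\<phi> n x\<close> into \<open>W\<close>, hence one of these points into
    \<open>P\<close> and the other into \<open>Q\<close>, which \<open>U\<close> excludes.\<close>
  obtain n where n: "n \<in> ?N" "?\<theta> n (f1 x) \<in> U" "?\<theta> n (f2 x) \<in> U"
    using contractive_pair[OF contractive_conj[OF S(1,2) g] U f1X[OF x] f2X[OF x]] by blast
  have y: "\<phi> n x \<in> topspace X" using act_closed[OF core_L[OF n(1)] x] .
  then obtain z where z: "z \<in> Z" "\<phi> (k z) (\<phi> n x) \<in> W" using Z(3) by blast
  have kz: "k z \<in> ?N" using k(1) z(1) Z(2) by blast
  have "?\<theta> (k z) (?\<theta> n (f1 x)) \<in> P" "?\<theta> (k z) (?\<theta> n (f2 x)) \<in> Q"
    using z(2) f1(2)[OF kz y] f2(2)[OF kz y] f1(2)[OF n(1) x] f2(2)[OF n(1) x] by (auto simp: W_def)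
  with UPQ[OF z(1)] n show False by blast
qed

end

section \<open>The coinduced boundary\<close>

text \<open>Zorn's lemma is applied to the open complements, where a chain is bounded by its union.
  Compactness keeps the union proper: if finitely many members covered the space, the largest of
  them would be the whole space.\<close>

lemma minimal_invariant_closed_exists:
  assumes cp: "compact_space Y" and ne: "topspace Y \<noteq> {}"
    and inv: "\<And>n. n \<in> N \<Longrightarrow> s n ` topspace Y \<subseteq> topspace Y"
  obtains M where "closedin Y M" "M \<noteq> {}" "\<And>n. n \<in> N \<Longrightarrow> s n ` M \<subseteq> M"
    "\<forall>K. closedin Y K \<longrightarrow> (\<forall>n\<in>N. s n ` K \<subseteq> K) \<longrightarrow> K \<subseteq> M \<longrightarrow> K = {} \<or> K = M"
proof -
  define \<A> where "\<A> = {U. openin Y U \<and> U \<noteq> topspace Y \<and>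
    (\<forall>n\<in>N. s n ` (topspace Y - U) \<subseteq> topspace Y - U)}"
  have "\<exists>M\<in>\<A>. \<forall>U\<in>\<A>. M \<subseteq> U \<longrightarrow> U = M"
  proof (rule subset_Zorn')
    fix \<C> assume ch: "subset.chain \<A> \<C>"
    show "\<Union>\<C> \<in> \<A>"
    proof (cases "\<C> = {}")
      case True
      show ?thesis
        unfolding True Union_empty \<A>_def mem_Collect_eq using inv not_sym[OF ne] by simp
    next
      case False
      have \<C>\<A>: "\<C> \<subseteq> \<A>" using ch by (simp add: subset.chain_def)
      then have op: "openin Y U" if "U \<in> \<C>" for U using that by (auto simp: \<A>_def)
      have "\<Union>\<C> \<noteq> topspace Y"
      proof
        assume "\<Union>\<C> = topspace Y"
        then obtain \<F> where \<F>: "finite \<F>" "\<F> \<subseteq> \<C>" "topspace Y \<subseteq> \<Union>\<F>"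
          using compactinD[of Y "topspace Y" \<C>] cp op by (auto simp: compact_space_def)
        then have "\<F> \<noteq> {}" using ne by auto
        moreover have "subset.chain \<A> \<F>"
          unfolding subset_chain_def
        proof (intro conjI ballI)
          show "\<F> \<subseteq> \<A>" using \<F>(2) \<C>\<A> by (rule order_trans)
          fix U V assume "U \<in> \<F>" "V \<in> \<F>"
          then have "U \<in> \<C>" "V \<in> \<C>" using \<F>(2) by auto
          then show "U \<subseteq> V \<or> V \<subseteq> U" using ch by (simp add: subset_chain_def)
        qed
        ultimately have "\<Union>\<F> \<in> \<F>" by (rule Union_in_chain[OF \<F>(1)])
        then have "\<Union>\<F> \<in> \<C>" using \<F>(2) by blast
        then have "\<Union>\<F> \<in> \<A>" using \<C>\<A> by blast
        moreover have "\<Union>\<F> \<subseteq> topspace Y" using \<F>(2) op openin_subset by blast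
        ultimately show False using \<F>(3) by (auto simp: \<A>_def)
      qed
      moreover have "s n x \<in> topspace Y - \<Union>\<C>" if "n \<in> N" "x \<in> topspace Y - \<Union>\<C>" for n x
      proof -
        have "s n x \<in> topspace Y - U" if "U \<in> \<C>" for U
        proof -
          have "s n ` (topspace Y - U) \<subseteq> topspace Y - U"
            using that \<C>\<A> \<open>n \<in> N\<close> by (auto simp: \<A>_def)
          with \<open>x \<in> topspace Y - \<Union>\<C>\<close> that show ?thesis by blast
        qed
        with False show ?thesis by blast
      qed
      ultimately show ?thesis using op by (auto simp: \<A>_def)
    qed
  qed
  then obtain U where U: "U \<in> \<A>" "\<And>V. V \<in> \<A> \<Longrightarrow> U \<subseteq> V \<Longrightarrow> V = U" by blast
  have UY: "openin Y U" "U \<subseteq> topspace Y" "U \<noteq> topspace Y"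
    using U(1) openin_subset by (auto simp: \<A>_def)
  show ?thesis
  proof
    show "closedin Y (topspace Y - U)" using UY by blast
    show "topspace Y - U \<noteq> {}" using UY by blast
    show "s n ` (topspace Y - U) \<subseteq> topspace Y - U" if "n \<in> N" for n
      using U(1) that by (simp add: \<A>_def)
    show "\<forall>K. closedin Y K \<longrightarrow> (\<forall>n\<in>N. s n ` K \<subseteq> K) \<longrightarrow> K \<subseteq> topspace Y - U \<longrightarrow>
        K = {} \<or> K = topspace Y - U"
    proof (intro allI impI)
      fix K assume K: "closedin Y K" "\<forall>n\<in>N. s n ` K \<subseteq> K" "K \<subseteq> topspace Y - U"
      have KY: "topspace Y - (topspace Y - K) = K" using closedin_subset[OF K(1)] by blast
      show "K = {} \<or> K = topspace Y - U"
      proof (cases "K = {}")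
        case False
        then have "topspace Y - K \<in> \<A>" using K(1,2) KY by (auto simp: \<A>_def)
        then have "topspace Y - K = U" using K(3) UY(2) by (intro U(2)) auto
        then show ?thesis using KY by auto
      qed simp
    qed
  qed
qed

text \<open>The shrunken boxes play the role of a Lebesgue number for the cover by the boxes \<open>B z\<close>.\<close>

lemma box_refinement:
  assumes Z: "finite Z" and C: "\<And>z i. z \<in> Z \<Longrightarrow> i \<in> J z \<Longrightarrow> openin X (C z i)"
    and B: "\<And>z i. z \<in> Z \<Longrightarrow> i \<in> J z \<Longrightarrow> openin X (B z i)"
    and CB: "\<And>z i. z \<in> Z \<Longrightarrow> i \<in> J z \<Longrightarrow> Abstract_Topology.closure_of X (C z i) \<subseteq> B z i"
    and x: "x \<in> topspace X"
  shows "\<exists>W. openin X W \<and> x \<in> W \<and> (\<forall>z\<in>Z. i \<in> J z \<longrightarrow> W \<inter> C z i = {} \<or> W \<subseteq> B z i)"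
proof -
  define A where "A z = (if x \<in> Abstract_Topology.closure_of X (C z i) then B z i
    else topspace X - Abstract_Topology.closure_of X (C z i))" for z
  define W where "W = topspace X \<inter> \<Inter>(A ` {z\<in>Z. i \<in> J z})"
  have "openin X W"
    unfolding W_def using Z B by (intro openin_Int_Inter) (auto simp: A_def)
  moreover have "x \<in> W" using x CB by (auto simp: W_def A_def)
  moreover have "W \<inter> C z i = {} \<or> W \<subseteq> B z i" if z: "z \<in> Z" "i \<in> J z" for z
  proof (cases "x \<in> Abstract_Topology.closure_of X (C z i)")
    case True
    then have "W \<subseteq> B z i" using z by (auto simp: W_def A_def)
    then show ?thesis ..
  next
    case False
    have "C z i \<subseteq> Abstract_Topology.closure_of X (C z i)"
      using C[OF z] by (simp add: closure_of_subset openin_subset)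
    moreover have "W \<subseteq> topspace X - Abstract_Topology.closure_of X (C z i)"
      using z False by (auto simp: W_def A_def)
    ultimately show ?thesis by blast
  qed
  ultimately show ?thesis by blast
qed

context commensurated_boundary
begin

section \<open>The coinduced space and its right translations\<close>

definition coind :: "('a \<Rightarrow> 'x) set" where
  "coind = {f \<in> (\<Pi>\<^sub>E g\<in>carrier G. topspace X). \<forall>l\<in>L. \<forall>g\<in>carrier G. f (l \<otimes> g) = \<phi> l (f g)}"

definition translate :: "'a \<Rightarrow> ('a \<Rightarrow> 'x) \<Rightarrow> 'a \<Rightarrow> 'x" where
  "translate h f = (\<lambda>g\<in>carrier G. f (g \<otimes> h))"

abbreviation coind_topology :: "('a \<Rightarrow> 'x) topology" where
  "coind_topology \<equiv> subtopology (product_topology (\<lambda>_. X) (carrier G)) coind"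

lemma coind_value: "f \<in> coind \<Longrightarrow> g \<in> carrier G \<Longrightarrow> f g \<in> topspace X"
  by (auto simp: coind_def)

lemma coind_equivariant: "f \<in> coind \<Longrightarrow> l \<in> L \<Longrightarrow> g \<in> carrier G \<Longrightarrow> f (l \<otimes> g) = \<phi> l (f g)"
  by (simp add: coind_def)

lemma topspace_coind: "topspace coind_topology = coind"
  by (auto simp: coind_def)

lemma translate_coind: "h \<in> carrier G \<Longrightarrow> f \<in> coind \<Longrightarrow> translate h f \<in> coind"
  by (auto simp: coind_def translate_def L_carrier m_assoc)

lemma translate_apply: "g \<in> carrier G \<Longrightarrow> translate h f g = f (g \<otimes> h)"
  by (simp add: translate_def)

lemma translate_mult:
  "h \<in> carrier G \<Longrightarrow> k \<in> carrier G \<Longrightarrow> translate (h \<otimes> k) f = translate h (translate k f)"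
  by (auto simp: translate_def m_assoc)

lemma translate_one: "f \<in> coind \<Longrightarrow> translate \<one> f = f"
  by (auto simp: translate_def coind_def PiE_def extensional_def)

lemma translate_core:
  assumes "n \<in> core S" "g \<in> S" "g \<in> carrier G" "f \<in> coind"
  shows "translate n f g = \<phi> (g \<otimes> n \<otimes> inv g) (f g)"
proof -
  have n: "n \<in> carrier G" using assms(1) by (simp add: core_L L_carrier)
  then have "g \<otimes> n = (g \<otimes> n \<otimes> inv g) \<otimes> g" using assms(3) by (simp add: m_assoc)
  then show ?thesis
    using coind_equivariant[OF assms(4) core_conj[OF assms(1,2)] assms(3)] assms(3)
    by (simp add: translate_apply)
qed

lemma continuous_eval: "g \<in> carrier G \<Longrightarrow> continuous_map (product_topology (\<lambda>_. X) (carrier G)) X (\<lambda>f. f g)"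
  by (rule continuous_map_product_projection)

lemma closedin_coind: "closedin (product_topology (\<lambda>_. X) (carrier G)) coind"
proof -
  let ?P = "product_topology (\<lambda>_. X) (carrier G)"
  let ?E = "\<lambda>(l, g). {f \<in> topspace ?P. f (l \<otimes> g) = \<phi> l (f g)}"
  have E: "closedin ?P (?E p)" if p: "p \<in> L \<times> carrier G" for p
  proof -
    obtain l g where lg: "p = (l, g)" "l \<in> L" "g \<in> carrier G" using p by auto
    have "continuous_map ?P X (\<phi> l \<circ> (\<lambda>f. f g))"
      using lg by (intro continuous_map_compose[OF continuous_eval act_cont])
    then show ?thesis
      using lg closedin_continuous_maps_eq[OF HX continuous_eval[of "l \<otimes> g"], of "\<lambda>f. \<phi> l (f g)"]
      by (simp add: L_carrier o_def)
  qed
  have "coind = topspace ?P \<inter> \<Inter>(?E ` (L \<times> carrier G))"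
    by (auto simp: coind_def)
  also have "closedin ?P \<dots>"
    using E L_one by (intro closedin_Int closedin_topspace closedin_Inter) auto
  finally show ?thesis .
qed

lemma compact_coind: "compact_space coind_topology"
  using closedin_coind cp
  by (intro compact_space_subtopology closedin_compact_space)
    (auto simp: compact_space_product_topology)

lemma continuous_translate:
  assumes "h \<in> carrier G"
  shows "continuous_map coind_topology coind_topology (translate h)"
proof -
  have "continuous_map coind_topology (product_topology (\<lambda>_. X) (carrier G)) (translate h)"
    unfolding continuous_map_componentwise
  proof (intro conjI ballI)
    show "translate h ` topspace coind_topology \<subseteq> extensional (carrier G)"
      by (auto simp: translate_def)
    fix g assume g: "g \<in> carrier G"
    then show "continuous_map coind_topology X (\<lambda>f. translate h f g)"
      using assms by (simp add: translate_apply continuous_map_from_subtopology continuous_eval)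
  qed
  then show ?thesis
    using translate_coind[OF assms] by (auto simp: continuous_map_in_subtopology topspace_coind)
qed

text \<open>A function in \<open>coind\<close> may be prescribed freely on representatives
  \<open>r g\<close> of the cosets \<open>L #> g\<close>; here it takes the value \<open>x\<close>
  on all of them.\<close>

lemma coind_nonempty: "coind \<noteq> {}"
proof -
  obtain x where x: "x \<in> topspace X" using ne by blast
  define r where "r g = (SOME h. h \<in> L #> g)" for g
  define f where "f = (\<lambda>g\<in>carrier G. \<phi> (g \<otimes> inv (r g)) x)"
  have r: "r g \<in> L #> g" if "g \<in> carrier G" for g
    unfolding r_def using rcos_self[OF that subL] by (rule someI)
  have r': "g \<otimes> inv (r g) \<in> L" "r g \<in> carrier G" if g: "g \<in> carrier G" for g
  proof -
    obtain l where l: "l \<in> L" "r g = l \<otimes> g" using r[OF g] by (auto simp: r_coset_def)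
    then show "r g \<in> carrier G" using g L_carrier by simp
    have "g \<otimes> inv (r g) = inv l" using l g L_carrier by (simp add: inv_mult_group mult_inv_cancel)
    then show "g \<otimes> inv (r g) \<in> L" using l L_inv by simp
  qed
  have r_eq: "r (l \<otimes> g) = r g" if "l \<in> L" "g \<in> carrier G" for l g
  proof -
    have "l \<otimes> g \<in> L #> g" using that by (auto simp: r_coset_def)
    then have "L #> g = L #> (l \<otimes> g)" by (rule repr_independence[OF _ that(2) subL])
    then show ?thesis by (simp add: r_def)
  qed
  have "f \<in> coind"
    unfolding coind_def
  proof (intro CollectI conjI ballI)
    show "f \<in> (\<Pi>\<^sub>E g\<in>carrier G. topspace X)" using r' x act_closed by (auto simp: f_def)
    fix l g assume l: "l \<in> L" and g: "g \<in> carrier G"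
    have "f (l \<otimes> g) = \<phi> (l \<otimes> (g \<otimes> inv (r g))) x"
      using l g r'(2)[OF g] L_carrier[OF l] by (simp add: f_def r_eq m_assoc)
    also have "\<dots> = \<phi> l (f g)"
      using act_mult[OF l r'(1)[OF g] x] g by (simp add: f_def)
    finally show "f (l \<otimes> g) = \<phi> l (f g)" .
  qed
  then show ?thesis by blast
qed

text \<open>Coordinates are contracted one after another: the neighbourhood into which a new coordinate is
  moved first is so small that each of the finitely many elements contracting the previous ones
  keeps it inside a member of the cover.\<close>

lemma contract_coordinates:
  assumes S: "finite S" "S \<subseteq> carrier G"
    and J: "J \<subseteq> S"
    and cover: "\<And>g x. g \<in> J \<Longrightarrow> x \<in> topspace X \<Longrightarrow> \<exists>V\<in>\<U> g. openin X V \<and> x \<in> V"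
    and e: "0 < (e::real)"
  shows "\<exists>F\<subseteq>core S. finite F \<and> (\<forall>m. charge coind m \<longrightarrow>
    (\<exists>n\<in>F. \<exists>V. (\<forall>g\<in>J. V g \<in> \<U> g) \<and> 1 - e \<le> m {f. \<forall>g\<in>J. translate n f g \<in> V g}))"
  using finite_subset[OF J S(1)] J cover e
proof (induction J arbitrary: e)
  case empty
  then show ?case
    using core_one[OF S(2)] by (intro exI[of _ "{\<one>}"]) (auto simp: charge_def)
next
  case (insert \<gamma> J)
  let ?\<theta> = "\<lambda>n. \<phi> (\<gamma> \<otimes> n \<otimes> inv \<gamma>)"
  have \<gamma>: "\<gamma> \<in> S" "\<gamma> \<in> carrier G" using insert.prems(1) S(2) by auto
  obtain F where F: "F \<subseteq> core S" "finite F"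
    "\<And>m. charge coind m \<Longrightarrow> \<exists>n\<in>F. \<exists>V. (\<forall>g\<in>J. V g \<in> \<U> g) \<and> 1 - e/2 \<le> m {f. \<forall>g\<in>J. translate n f g \<in> V g}"
    using insert.IH[of "e/2"] insert.prems by auto
  have "\<exists>U\<subseteq>topspace X. openin X U \<and> U \<noteq> {} \<and> (\<forall>n\<in>F. \<exists>V\<in>\<U> \<gamma>. \<forall>u\<in>U. ?\<theta> n u \<in> V)"
  proof (rule finite_shrink_open[OF F(2) openin_topspace ne])
    fix n U assume n: "n \<in> F" and U: "openin X U" "U \<noteq> {}"
    obtain u where u: "u \<in> U" "u \<in> topspace X" using U openin_subset by blast
    have nL: "\<gamma> \<otimes> n \<otimes> inv \<gamma> \<in> L" using n F(1) \<gamma> core_conj by blast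
    obtain V where V: "V \<in> \<U> \<gamma>" "openin X V" "?\<theta> n u \<in> V"
      using insert.prems(2)[of \<gamma>] act_closed[OF nL u(2)] by blast
    show "\<exists>V'\<subseteq>U. openin X V' \<and> V' \<noteq> {} \<and> (\<exists>V\<in>\<U> \<gamma>. \<forall>u\<in>V'. ?\<theta> n u \<in> V)"
      using U V u act_open[OF nL V(2)]
      by (intro exI[of _ "U \<inter> {x \<in> topspace X. ?\<theta> n x \<in> V}"]) (auto intro: openin_Int)
  qed blast
  then obtain U where U: "openin X U" "U \<noteq> {}"
    "\<And>n. n \<in> F \<Longrightarrow> \<exists>V\<in>\<U> \<gamma>. \<forall>u\<in>U. ?\<theta> n u \<in> V" by blast
  have "\<exists>F1\<subseteq>core S. finite F1 \<and> (\<forall>m. charge (topspace X) m \<longrightarrow> (\<exists>n\<in>F1. 1 - e/2 \<le> m {x. ?\<theta> n x \<in> U}))"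
    using contractive_conj[OF S \<gamma>(2), unfolded contractive_def, rule_format, OF U(1,2), of "e/2"]
      insert.prems(3) by simp
  then obtain F1 where F1: "F1 \<subseteq> core S" "finite F1"
    "\<And>m. charge (topspace X) m \<Longrightarrow> \<exists>n\<in>F1. 1 - e/2 \<le> m {x. ?\<theta> n x \<in> U}" by blast
  show ?case
  proof (intro exI[of _ "(\<lambda>(k, n). k \<otimes> n) ` (F \<times> F1)"] conjI allI impI)
    show "(\<lambda>(k, n). k \<otimes> n) ` (F \<times> F1) \<subseteq> core S"
      using F(1) F1(1) core_mult[OF S(2)] by auto
    show "finite ((\<lambda>(k, n). k \<otimes> n) ` (F \<times> F1))" using F(2) F1(2) by simp
    fix m assume m: "charge coind m"
    have "charge (topspace X) (\<lambda>A. m ((\<lambda>f. f \<gamma>) -` A))"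
      using m by (rule charge_vimage) (use \<gamma> in \<open>auto simp: coind_value\<close>)
    then obtain n where n: "n \<in> F1" "1 - e/2 \<le> m ((\<lambda>f. f \<gamma>) -` {x. ?\<theta> n x \<in> U})"
      using F1(3) by blast
    have nc: "n \<in> core S" "n \<in> carrier G" using n(1) F1(1) core_L L_carrier by auto
    \<comment> \<open>The elements of \<open>F\<close> are applied to the charge already moved by
      \<open>n\<close>. So \<open>k\<close> is chosen after \<open>n\<close>, and
      \<open>k \<otimes> n\<close> contracts the old coordinates and the new one together.\<close>
    have "charge coind (\<lambda>A. m (translate n -` A))"
      using m by (rule charge_vimage) (use nc translate_coind in auto)
    then obtain k V where k: "k \<in> F" "\<forall>g\<in>J. V g \<in> \<U> g"
      "1 - e/2 \<le> m (translate n -` {f. \<forall>g\<in>J. translate k f g \<in> V g})"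
      using F(3) by blast
    have kc: "k \<in> core S" "k \<in> carrier G" using k(1) F(1) core_L L_carrier by auto
    obtain V\<gamma> where V\<gamma>: "V\<gamma> \<in> \<U> \<gamma>" "\<forall>u\<in>U. ?\<theta> k u \<in> V\<gamma>" using U(3)[OF k(1)] by blast
    let ?A = "(\<lambda>f. f \<gamma>) -` {x. ?\<theta> n x \<in> U}" and ?B = "translate n -` {f. \<forall>g\<in>J. translate k f g \<in> V g}"
    let ?V = "V(\<gamma> := V\<gamma>)"
    have "translate (k \<otimes> n) f g \<in> ?V g" if f: "f \<in> ?A \<inter> ?B" "f \<in> coind" and g: "g \<in> insert \<gamma> J" for f g
    proof -
      have t: "translate (k \<otimes> n) f = translate k (translate n f)"
        using kc nc by (simp add: translate_mult)
      have "translate k (translate n f) \<gamma> = ?\<theta> k (?\<theta> n (f \<gamma>))"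
        using translate_core[OF kc(1) \<gamma> translate_coind[OF nc(2) f(2)]]
          translate_core[OF nc(1) \<gamma> f(2)] by simp
      then have "translate k (translate n f) \<gamma> \<in> V\<gamma>" using V\<gamma>(2) f(1) by simp
      with t g f(1) show ?thesis by auto
    qed
    then have "m (?A \<inter> ?B) \<le> m {f. \<forall>g\<in>insert \<gamma> J. translate (k \<otimes> n) f g \<in> ?V g}"
      by (intro charge_mono_on[OF m]) blast
    \<comment> \<open>Two sets of mass at least \<open>1 - e/2\<close> meet in mass at least
      \<open>1 - e\<close>.\<close>
    then have "1 - e \<le> m {f. \<forall>g\<in>insert \<gamma> J. translate (k \<otimes> n) f g \<in> ?V g}"
      using charge_Int_ge[OF m, of ?A ?B] n(2) k(3) by linarith
    moreover have "\<forall>g\<in>insert \<gamma> J. ?V g \<in> \<U> g" using k(2) V\<gamma>(1) by auto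
    ultimately have "\<exists>V. (\<forall>g\<in>insert \<gamma> J. V g \<in> \<U> g) \<and> 1 - e \<le> m {f. \<forall>g\<in>insert \<gamma> J. translate (k \<otimes> n) f g \<in> V g}"
      by (intro exI[of _ ?V] conjI)
    then show "\<exists>n\<in>(\<lambda>(k, n). k \<otimes> n) ` (F \<times> F1). \<exists>V. (\<forall>g\<in>insert \<gamma> J. V g \<in> \<U> g) \<and>
        1 - e \<le> m {f. \<forall>g\<in>insert \<gamma> J. translate n f g \<in> V g}"
      using k(1) n(1) by (intro bexI[of _ "k \<otimes> n"]) auto
  qed
qed

text \<open>In a minimal set \<open>M\<close> each \<open>f\<close> has a box around it whose part
  in \<open>M\<close> some \<open>l f\<close> carries into the given \<open>U\<close>. Finitely many
  such boxes are needed, and a charge can be concentrated in a set so fine that it lies inside one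
  of them; the corresponding \<open>l f\<close> then takes this mass into \<open>U\<close>.\<close>

lemma coind_boundary_exists:
  obtains M where "M \<subseteq> coind"
    "boundary_action (G\<lparr>carrier := L\<rparr>) (subtopology coind_topology M) (\<lambda>l. restrict (translate l) M)"
proof -
  let ?T = coind_topology and ?GL = "G\<lparr>carrier := L\<rparr>"
  obtain M where M: "closedin ?T M" "M \<noteq> {}" "\<And>l. l \<in> L \<Longrightarrow> translate l ` M \<subseteq> M"
    and Mmin: "\<forall>K. closedin ?T K \<longrightarrow> (\<forall>l\<in>L. translate l ` K \<subseteq> K) \<longrightarrow> K \<subseteq> M \<longrightarrow> K = {} \<or> K = M"
  proof (rule minimal_invariant_closed_exists[OF compact_coind, of L translate])
    show "topspace ?T \<noteq> {}" unfolding topspace_coind by (rule coind_nonempty)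
    show "translate n ` topspace ?T \<subseteq> topspace ?T" if "n \<in> L" for n
      unfolding topspace_coind using translate_coind[OF L_carrier[OF that]] by blast
  qed (rule that)
  have MY: "M \<subseteq> coind" using closedin_subset[OF M(1)] by (simp only: topspace_coind)
  let ?M = "subtopology ?T M"
  have tM: "topspace ?M = M" 
    using MY unfolding topspace_subtopology[of ?T M] topspace_coind by blast
  have cM: "compact_space ?M"
    by (rule compact_space_subtopology[OF closedin_compact_space[OF compact_coind M(1)]])
  have HM: "Hausdorff_space ?M"
    by (intro Hausdorff_space_subtopology) (simp add: Hausdorff_space_product_topology HX)
  have ctr: "continuous_map ?M ?M (translate l)" if "l \<in> L" for l
    using continuous_translate[OF L_carrier[OF that]] M(3)[OF that] tM
    by (auto simp: continuous_map_in_subtopology continuous_map_from_subtopology)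
  have grp: "group ?GL" using subL subgroup_imp_group by blast
  have hoM: "homeo_action ?GL ?M (\<lambda>l. restrict (translate l) M)"
    using homeo_actionI[OF grp, of ?M translate] ctr MY translate_mult translate_one L_carrier
    unfolding tM by (simp add: subset_iff)
  have miM: "minimal_action ?GL ?M (\<lambda>l. restrict (translate l) M)"
    unfolding minimal_action_def tM
  proof (intro allI impI)
    fix K assume K: "closedin ?M K" "\<forall>l\<in>carrier ?GL. restrict (translate l) M ` K \<subseteq> K"
    then have KM: "K \<subseteq> M" using closedin_subset[OF K(1)] tM by simp
    have "closedin ?T K" using K(1) M(1) closedin_closed_subtopology by blast
    moreover have "translate l ` K \<subseteq> K" if "l \<in> L" for l
    proof clarify
      fix k assume k: "k \<in> K"
      have "restrict (translate l) M ` K \<subseteq> K" using K(2) that by simp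
      then have "restrict (translate l) M k \<in> K" using k by blast
      then show "translate l k \<in> K" using k KM by (simp add: subset_iff)
    qed
    ultimately show "K = {} \<or> K = M" using KM Mmin by blast
  qed
  have "contractive ?M L (\<lambda>l. restrict (translate l) M)"
    unfolding contractive_def tM
  proof (intro allI impI)
    fix U and e :: real assume U: "openin ?M U" "U \<noteq> {}" and e: "0 < e"
    have UM: "U \<subseteq> M" using openin_subset[OF U(1)] tM by simp
    have "\<exists>l\<in>L. translate l f \<in> U" if "f \<in> M" for f
      using minimal_action_hits[OF hoM miM U, of f] that tM by auto
    then obtain l where l: "\<And>f. f \<in> M \<Longrightarrow> l f \<in> L" "\<And>f. f \<in> M \<Longrightarrow> translate (l f) f \<in> U" by metis
    define Q where "Q f B \<longleftrightarrow> finite {g \<in> carrier G. B g \<noteq> topspace X} \<and>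
        (\<forall>g\<in>carrier G. openin X (B g)) \<and> f \<in> Pi\<^sub>E (carrier G) B \<and>
        (\<forall>h\<in>Pi\<^sub>E (carrier G) B \<inter> M. translate (l f) h \<in> U)" for f B
    have "\<exists>B. Q f B" if f: "f \<in> M" for f
    proof -
      have "openin ?M {h \<in> topspace ?M. translate (l f) h \<in> U}"
        by (rule openin_continuous_map_preimage[OF ctr[OF l(1)[OF f]] U(1)])
      then have "openin ?M {h \<in> M. translate (l f) h \<in> U}" unfolding tM .
      moreover have "?M = subtopology (product_topology (\<lambda>_. X) (carrier G)) M"
        using MY by (simp add: subtopology_subtopology Int_absorb1)
      ultimately have "openin (subtopology (product_topology (\<lambda>_. X) (carrier G)) M)
          {h \<in> M. translate (l f) h \<in> U}"
        by (simp only:)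
      then obtain O' where O': "openin (product_topology (\<lambda>_. X) (carrier G)) O'"
        "{h \<in> M. translate (l f) h \<in> U} = O' \<inter> M"
        by (auto simp: openin_subtopology)
      have "f \<in> O'" using O'(2) f l(2)[OF f] by blast
      then obtain B where B: "finite {g \<in> carrier G. B g \<noteq> topspace X}" "\<forall>g\<in>carrier G. openin X (B g)"
        "f \<in> Pi\<^sub>E (carrier G) B" "Pi\<^sub>E (carrier G) B \<subseteq> O'"
        using O'(1) unfolding openin_product_topology_alt by blast
      have "translate (l f) h \<in> U" if "h \<in> Pi\<^sub>E (carrier G) B \<inter> M" for h
        using that B(4) O'(2) by blast
      with B(1-3) show ?thesis unfolding Q_def by (intro exI[of _ B]) simp
    qed
    then obtain B where "\<And>f. f \<in> M \<Longrightarrow> Q f (B f)" by metis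
    then have Bfin: "\<And>f. f \<in> M \<Longrightarrow> finite {g \<in> carrier G. B f g \<noteq> topspace X}"
      and Bop: "\<And>f g. f \<in> M \<Longrightarrow> g \<in> carrier G \<Longrightarrow> openin X (B f g)"
      and fB: "\<And>f. f \<in> M \<Longrightarrow> f \<in> Pi\<^sub>E (carrier G) (B f)"
      and BU: "\<And>f h. f \<in> M \<Longrightarrow> h \<in> Pi\<^sub>E (carrier G) (B f) \<Longrightarrow> h \<in> M \<Longrightarrow> translate (l f) h \<in> U"
      by (simp_all add: Q_def)
    define J where "J f = {g \<in> carrier G. B f g \<noteq> topspace X}" for f
    have nrm: "normal_space X"
      using cp HX by (simp add: compact_Hausdorff_or_regular_imp_normal_space)
    have "\<exists>C. openin X C \<and> f g \<in> C \<and> Abstract_Topology.closure_of X C \<subseteq> B f g"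
      if f: "f \<in> M" and g: "g \<in> carrier G" for f g
    proof -
      have "f g \<in> topspace X" using f g MY coind_value by blast
      then have "closedin X {f g}" using HX by (simp add: closedin_Hausdorff_singleton)
      moreover have "{f g} \<subseteq> B f g" using fB[OF f] g by auto
      ultimately obtain C where "openin X C" "{f g} \<subseteq> C" "Abstract_Topology.closure_of X C \<subseteq> B f g"
        using nrm Bop[OF f g] unfolding normal_space_alt by meson
      then show ?thesis by auto
    qed
    then obtain C where C: "\<And>f g. f \<in> M \<Longrightarrow> g \<in> carrier G \<Longrightarrow> openin X (C f g)"
      "\<And>f g. f \<in> M \<Longrightarrow> g \<in> carrier G \<Longrightarrow> f g \<in> C f g"
      "\<And>f g. f \<in> M \<Longrightarrow> g \<in> carrier G \<Longrightarrow> Abstract_Topology.closure_of X (C f g) \<subseteq> B f g"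
      by metis
    \<comment> \<open>A smaller box around \<open>f\<close>: the closures of its sides lie in the
      sides of \<open>B f\<close>, and only the finitely many restricted coordinates
      \<open>J f\<close> are involved.\<close>
    define E where "E f = topspace ?M \<inter> \<Inter>((\<lambda>g. {h \<in> topspace ?M. h g \<in> C f g}) ` J f)" for f
    have Eo: "openin ?M (E f)" if f: "f \<in> M" for f
      unfolding E_def
    proof (rule openin_Int_Inter)
      show "finite ((\<lambda>g. {h \<in> topspace ?M. h g \<in> C f g}) ` J f)" using Bfin[OF f] by (simp add: J_def)
      fix A assume "A \<in> (\<lambda>g. {h \<in> topspace ?M. h g \<in> C f g}) ` J f"
      then obtain g where g: "g \<in> carrier G" "A = {h \<in> topspace ?M. h g \<in> C f g}" by (auto simp: J_def)
      have "continuous_map ?M X (\<lambda>h. h g)"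
        using continuous_eval[OF g(1)] by (simp add: continuous_map_from_subtopology)
      then show "openin ?M A"
        unfolding g(2) using C(1)[OF f g(1)] by (rule openin_continuous_map_preimage)
    qed (rule openin_topspace)
    have fE: "f \<in> E f" if "f \<in> M" for f
      using that C(2)[OF that] unfolding E_def tM by (auto simp: J_def)
    obtain Z where Z: "finite Z" "Z \<subseteq> topspace ?M" "topspace ?M \<subseteq> (\<Union>f\<in>Z. E f)"
      by (rule compact_space_finite_neighbourhoods[OF cM, of E]) (use Eo fE in \<open>simp_all only: tM\<close>)
    have ZM: "Z \<subseteq> M" and MZ: "M \<subseteq> (\<Union>f\<in>Z. E f)" using Z(2,3) tM by simp_all
    define S where "S = (\<Union>f\<in>Z. J f)"
    have S: "finite S" "S \<subseteq> carrier G" using Z(1) ZM Bfin by (auto simp: S_def J_def)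
    \<comment> \<open>A member that meets the small side \<open>C f g\<close> lies in the large side
      \<open>B f g\<close>, for all \<open>f \<in> Z\<close> with \<open>g \<in> J f\<close> at
      once.\<close>
    define \<U> where "\<U> g = {W. \<forall>f\<in>Z. g \<in> J f \<longrightarrow> W \<inter> C f g = {} \<or> W \<subseteq> B f g}" for g
    have cover: "\<exists>W\<in>\<U> g. openin X W \<and> x \<in> W" if "x \<in> topspace X" for g x
    proof -
      have "\<exists>W. openin X W \<and> x \<in> W \<and> (\<forall>f\<in>Z. g \<in> J f \<longrightarrow> W \<inter> C f g = {} \<or> W \<subseteq> B f g)"
      proof (rule box_refinement[OF Z(1) _ _ _ that])
        fix f i assume "f \<in> Z" "i \<in> J f"
        then have fi: "f \<in> M" "i \<in> carrier G" using ZM by (auto simp: J_def)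
        show "openin X (C f i)" by (rule C(1)[OF fi])
        show "openin X (B f i)" by (rule Bop[OF fi])
        show "Abstract_Topology.closure_of X (C f i) \<subseteq> B f i" by (rule C(3)[OF fi])
      qed
      then show ?thesis by (auto simp: \<U>_def)
    qed
    \<comment> \<open>With \<open>d < 1\<close> the set in which the charge is concentrated has
      positive mass, so it contains a point \<open>h\<close> of \<open>M\<close>.\<close>
    define d where "d = min e (1/2)"
    have d: "0 < d" "d < 1" "d \<le> e" using e by (auto simp: d_def)
    have "\<exists>F\<subseteq>core S. finite F \<and> (\<forall>m. charge coind m \<longrightarrow>
        (\<exists>n\<in>F. \<exists>V. (\<forall>g\<in>S. V g \<in> \<U> g) \<and> 1 - d \<le> m {f. \<forall>g\<in>S. translate n f g \<in> V g}))"
      by (rule contract_coordinates[OF S subset_refl cover d(1)])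
    then obtain F where F: "F \<subseteq> core S" "finite F"
      "\<forall>m. charge coind m \<longrightarrow>
        (\<exists>n\<in>F. \<exists>V. (\<forall>g\<in>S. V g \<in> \<U> g) \<and> 1 - d \<le> m {f. \<forall>g\<in>S. translate n f g \<in> V g})"
      by (elim exE conjE)
    show "\<exists>F\<subseteq>L. finite F \<and> (\<forall>m. charge M m \<longrightarrow>
        (\<exists>k\<in>F. 1 - e \<le> m {f. restrict (translate k) M f \<in> U}))"
    proof (intro exI[of _ "(\<lambda>(f, n). l f \<otimes> n) ` (Z \<times> F)"] conjI allI impI)
      show "(\<lambda>(f, n). l f \<otimes> n) ` (Z \<times> F) \<subseteq> L"
      proof clarify
        fix f n assume "f \<in> Z" "n \<in> F"
        then have "f \<in> M" "n \<in> core S" using ZM F(1) by auto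
        then show "l f \<otimes> n \<in> L" by (intro L_mult l(1) core_L)
      qed
      show "finite ((\<lambda>(f, n). l f \<otimes> n) ` (Z \<times> F))" using Z(1) F(2) by simp
      fix m assume m: "charge M m"
      \<comment> \<open>The contraction of coordinates was proved on all of \<open>coind\<close>; a
        charge on \<open>M\<close> is in particular one there.\<close>
      have "charge coind m"
        using charge_vimage[OF m, of "\<lambda>f. f" coind] MY by auto
      then obtain n V where n: "n \<in> F" "\<And>g. g \<in> S \<Longrightarrow> V g \<in> \<U> g"
        "1 - d \<le> m {f. \<forall>g\<in>S. translate n f g \<in> V g}"
        using F(3) by blast
      let ?A = "{f. \<forall>g\<in>S. translate n f g \<in> V g}"
      have nL: "n \<in> L" using n(1) F(1) core_L by blast
      have "\<exists>h\<in>M. h \<in> ?A"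
      proof (rule ccontr)
        assume "\<not> ?thesis"
        then have "m ?A \<le> m {}" by (intro charge_mono_on[OF m]) blast
        with n(3) d show False by (simp add: charge_empty[OF m])
      qed
      then obtain h where h: "h \<in> M" "\<And>g. g \<in> S \<Longrightarrow> translate n h g \<in> V g" by blast
      have "translate n h \<in> M" using M(3)[OF nL] h(1) by blast
      \<comment> \<open>The single point \<open>h\<close> selects the box: every side
        \<open>V g\<close> with \<open>g \<in> J f\<close> meets \<open>C f g\<close> in
        \<open>translate n h g\<close>, so it lies in \<open>B f g\<close>, and \<open>l f\<close>
        works for all of \<open>?A\<close> in \<open>M\<close>.\<close>
      then obtain f where f: "f \<in> Z" "translate n h \<in> E f" using MZ by blast
      have fM: "f \<in> M" using f(1) ZM by blast
      have VB: "V g \<subseteq> B f g" if g: "g \<in> J f" for g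
      proof -
        have gS: "g \<in> S" using f(1) g by (auto simp: S_def)
        have "translate n h g \<in> V g \<inter> C f g" using h(2)[OF gS] f(2) g by (auto simp: E_def)
        then show ?thesis using n(2)[OF gS] f(1) g by (auto simp: \<U>_def)
      qed
      have "translate (l f \<otimes> n) k \<in> U" if k: "k \<in> M" "k \<in> ?A" for k
      proof -
        have tk: "translate n k \<in> M" using M(3)[OF nL] k(1) by blast
        have "translate n k \<in> Pi\<^sub>E (carrier G) (B f)"
        proof (intro PiE_I)
          fix g assume g: "g \<in> carrier G"
          show "translate n k g \<in> B f g"
          proof (cases "g \<in> J f")
            case True
            then have "g \<in> S" using f(1) by (auto simp: S_def)
            then show ?thesis using VB[OF True] k(2) by blast
          next
            case False
            then show ?thesis using g tk MY coind_value[of "translate n k" g] by (auto simp: J_def)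
          qed
        qed (simp add: translate_def)
        then have "translate (l f) (translate n k) \<in> U" by (rule BU[OF fM _ tk])
        then show ?thesis
          using translate_mult[OF L_carrier[OF l(1)[OF fM]] L_carrier[OF nL]] by simp
      qed
      then have "m ?A \<le> m {k. restrict (translate (l f \<otimes> n)) M k \<in> U}"
        by (intro charge_mono_on[OF m]) auto
      then have "1 - e \<le> m {k. restrict (translate (l f \<otimes> n)) M k \<in> U}"
        using n(3) d(3) by linarith
      then show "\<exists>k\<in>(\<lambda>(f, n). l f \<otimes> n) ` (Z \<times> F). 1 - e \<le> m {f. restrict (translate k) M f \<in> U}"
        using f(1) n(1) by (intro bexI[of _ "l f \<otimes> n"]) auto
    qed
  qed
  then have "boundary_action ?GL ?M (\<lambda>l. restrict (translate l) M)"
    using cM HM hoM M(2) tM by (intro contractive_imp_boundary) auto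
  with MY show ?thesis by (rule that)
qed

end

section \<open>Universality for boundaries on arbitrary types\<close>

text \<open>Passing through contraction, only charges have to be pushed forward along
  \<open>q\<close>; regular probabilities on the two spaces and their topologies need not be
  compared.\<close>

lemma boundary_action_transport:
  assumes bd: "boundary_action G Y \<psi>" and pq: "homeomorphic_maps Y Z p q"
  shows "boundary_action G Z (\<lambda>g. restrict (\<lambda>z. p (\<psi> g (q z))) (topspace Z))"
proof (rule contractive_imp_boundary)
  have cY: "compact_space Y" and HY: "Hausdorff_space Y" and nY: "topspace Y \<noteq> {}" and ho: "homeo_action G Y \<psi>"
    using bd by (auto simp: boundary_action_def)
  have p: "continuous_map Y Z p" and q: "continuous_map Z Y q"
    and qp: "\<And>y. y \<in> topspace Y \<Longrightarrow> q (p y) = y" and pq': "\<And>z. z \<in> topspace Z \<Longrightarrow> p (q z) = z"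
    using pq by (auto simp: homeomorphic_maps_def)
  have hs: "Y homeomorphic_space Z" using pq by (auto simp: homeomorphic_space_def)
  have pZ: "p y \<in> topspace Z" if "y \<in> topspace Y" for y
    using continuous_map_image_subset_topspace[OF p] that by blast
  have qY: "q z \<in> topspace Y" if "z \<in> topspace Z" for z
    using continuous_map_image_subset_topspace[OF q] that by blast
  show "compact_space Z" using hs cY homeomorphic_compact_space by blast
  show "Hausdorff_space Z" using hs HY homeomorphic_Hausdorff_space by blast
  show "topspace Z \<noteq> {}" using nY pZ by blast
  have grp: "group G"
    using ho group_action.group_hom group_hom.axioms(1) unfolding homeo_action_def by blast
  show "homeo_action G Z (\<lambda>g. restrict (\<lambda>z. p (\<psi> g (q z))) (topspace Z))"
  proof (rule homeo_actionI[OF grp])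
    fix g assume g: "g \<in> carrier G"
    show "continuous_map Z Z (\<lambda>z. p (\<psi> g (q z)))"
      using continuous_map_compose[OF continuous_map_compose[OF q homeo_action_continuous[OF ho g]] p]
      by (simp add: o_def)
    fix h z assume h: "h \<in> carrier G" and z: "z \<in> topspace Z"
    show "p (\<psi> (g \<otimes>\<^bsub>G\<^esub> h) (q z)) = p (\<psi> g (q (p (\<psi> h (q z)))))"
      using homeo_action_mult[OF ho g h qY[OF z]] qp[OF homeo_action_closed[OF ho h qY[OF z]]] by simp
  next
    fix z assume "z \<in> topspace Z"
    then show "p (\<psi> \<one>\<^bsub>G\<^esub> (q z)) = z" using homeo_action_one[OF ho] qY pq' by simp
  qed
  show "contractive Z (carrier G) (\<lambda>g. restrict (\<lambda>z. p (\<psi> g (q z))) (topspace Z))"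
    unfolding contractive_def
  proof (intro allI impI)
    fix U and e :: real assume U: "openin Z U" "U \<noteq> {}" and e: "0 < e"
    let ?U = "{y \<in> topspace Y. p y \<in> U}"
    have U': "openin Y ?U" using p U(1) by (rule openin_continuous_map_preimage)
    obtain u where u: "u \<in> U" "u \<in> topspace Z" using U openin_subset by blast
    then have "q u \<in> ?U" using qY pq' by simp
    then have U'': "?U \<noteq> {}" by blast
    obtain F where F: "F \<subseteq> carrier G" "finite F"
      "\<And>m. charge (topspace Y) m \<Longrightarrow> \<exists>g\<in>F. 1 - e \<le> m {y. \<psi> g y \<in> ?U}"
      using boundary_imp_contractive[OF bd, unfolded contractive_def, rule_format, OF U' U'' e] by blast
    show "\<exists>F\<subseteq>carrier G. finite F \<and> (\<forall>m. charge (topspace Z) m \<longrightarrow>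
        (\<exists>g\<in>F. 1 - e \<le> m {z. restrict (\<lambda>z. p (\<psi> g (q z))) (topspace Z) z \<in> U}))"
    proof (intro exI[of _ F] conjI allI impI)
      fix m assume m: "charge (topspace Z) m"
      have "charge (topspace Y) (\<lambda>A. m (q -` A))"
        using m by (rule charge_vimage) (use qY in auto)
      then obtain g where g: "g \<in> F" "1 - e \<le> m (q -` {y. \<psi> g y \<in> ?U})" using F(3) by blast
      have "m (q -` {y. \<psi> g y \<in> ?U}) \<le> m {z. restrict (\<lambda>z. p (\<psi> g (q z))) (topspace Z) z \<in> U}"
        by (intro charge_mono_on[OF m]) auto
      with g show "\<exists>g\<in>F. 1 - e \<le> m {z. restrict (\<lambda>z. p (\<psi> g (q z))) (topspace Z) z \<in> U}"
        by (intro bexI[of _ g]) auto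
    qed (use F in auto)
  qed
qed

lemma homeomorphic_maps_inj_image:
  assumes "inj_on e (topspace Y)"
  shows "homeomorphic_maps Y (pullback_topology (e ` topspace Y) (inv_into (topspace Y) e) Y)
    e (inv_into (topspace Y) e)"
  unfolding homeomorphic_maps_def
proof (intro conjI ballI)
  let ?i = "inv_into (topspace Y) e" and ?Z = "pullback_topology (e ` topspace Y) (inv_into (topspace Y) e) Y"
  have top: "topspace ?Z = e ` topspace Y"
    using assms by (auto simp: topspace_pullback_topology)
  show "continuous_map Y ?Z e"
  proof (rule continuous_map_pullback')
    show "continuous_map Y Y (?i \<circ> e)"
      using assms by (intro continuous_map_eq[OF continuous_map_id]) simp
  qed auto
  show "continuous_map ?Z Y ?i"
    using continuous_map_pullback[OF continuous_map_id, of "e ` topspace Y" ?i Y] by simp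
  show "?i (e y) = y" if "y \<in> topspace Y" for y using assms that by simp
  show "e (?i z) = z" if "z \<in> topspace ?Z" for z
    using that unfolding top by (rule f_inv_into_f)
qed

text \<open>The definition speaks of boundaries on \<open>'g set set\<close>, whereas the coinduced
  boundary consists of functions. A copy of \<open>Y\<close> is made on the image of an embedding
  \<open>e\<close>, and the map obtained is followed by the inverse of \<open>e\<close>.\<close>

lemma furstenberg_boundary_universal:
  fixes G :: "('g, 'b) monoid_scheme" and Y :: "'y topology"
  assumes fb: "furstenberg_boundary G X \<phi>" and bd: "boundary_action G Y \<psi>"
  obtains f where "continuous_map X Y f"
    "\<And>g x. g \<in> carrier G \<Longrightarrow> x \<in> topspace X \<Longrightarrow> f (\<phi> g x) = \<psi> g (f x)"
proof -
  obtain e :: "'y \<Rightarrow> 'g set set" where e: "inj_on e (topspace Y)"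
    using boundary_action_embeds[OF bd] by blast
  let ?i = "inv_into (topspace Y) e"
  define Z where "Z = pullback_topology (e ` topspace Y) ?i Y"
  have hm: "homeomorphic_maps Y Z e ?i"
    unfolding Z_def using e by (rule homeomorphic_maps_inj_image)
  note universal = conjunct2[OF fb[unfolded furstenberg_boundary_def], rule_format]
  obtain f where f: "continuous_map X Z f"
    "\<forall>g\<in>carrier G. \<forall>x\<in>topspace X. f (\<phi> g x) = restrict (\<lambda>z. e (\<psi> g (?i z))) (topspace Z) (f x)"
    using universal[OF boundary_action_transport[OF bd hm]] by (elim exE conjE)
  have ho: "homeo_action G Y \<psi>" using bd by (simp add: boundary_action_def)
  have i: "continuous_map Z Y ?i" "\<And>y. y \<in> topspace Y \<Longrightarrow> ?i (e y) = y"
    using hm by (auto simp: homeomorphic_maps_def)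
  have fZ: "f x \<in> topspace Z" if "x \<in> topspace X" for x
    using continuous_map_image_subset_topspace[OF f(1)] that by blast
  have iY: "?i z \<in> topspace Y" if "z \<in> topspace Z" for z
    using continuous_map_image_subset_topspace[OF i(1)] that by blast
  show ?thesis
  proof
    show "continuous_map X Y (?i \<circ> f)" using f(1) i(1) by (rule continuous_map_compose)
    show "(?i \<circ> f) (\<phi> g x) = \<psi> g ((?i \<circ> f) x)" if g: "g \<in> carrier G" and x: "x \<in> topspace X" for g x
      using bspec[OF bspec[OF f(2) g] x] fZ[OF x] i(2)[OF homeo_action_closed[OF ho g iY[OF fZ[OF x]]]] by simp
  qed
qed

section \<open>Construction and uniqueness of the extended action\<close>

theorem theorem3p1:
  fixes \<Gamma> :: "('g, 'b) monoid_scheme" and \<Lambda> :: "'g set"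
    and X :: "'x topology" and \<phi> :: "'g \<Rightarrow> 'x \<Rightarrow> 'x"
  assumes "group \<Gamma>" and "subgroup \<Lambda> \<Gamma>" and "commensurated \<Gamma> \<Lambda>"
    and "furstenberg_boundary (\<Gamma>\<lparr>carrier := \<Lambda>\<rparr>) X \<phi>"
  shows "\<exists>\<psi>. (homeo_action \<Gamma> X \<psi> \<and> (\<forall>l\<in>\<Lambda>. \<forall>x\<in>topspace X. \<psi> l x = \<phi> l x)) \<and>
           (\<forall>\<psi>'. homeo_action \<Gamma> X \<psi>' \<and> (\<forall>l\<in>\<Lambda>. \<forall>x\<in>topspace X. \<psi>' l x = \<phi> l x) \<longrightarrow>
              (\<forall>g\<in>carrier \<Gamma>. \<forall>x\<in>topspace X. \<psi>' g x = \<psi> g x))"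
proof -
  have bd: "boundary_action (\<Gamma>\<lparr>carrier := \<Lambda>\<rparr>) X \<phi>"
    using assms(4) by (simp add: furstenberg_boundary_def)
  have "commensurated_boundary_axioms \<Gamma> \<Lambda> X \<phi>"
    using assms(2,3) bd boundary_imp_contractive[OF bd]
    by (intro commensurated_boundary_axioms.intro) (simp_all add: boundary_action_def)
  then interpret commensurated_boundary \<Gamma> \<Lambda> X \<phi>
    using assms(1) by (intro commensurated_boundary.intro)
  obtain M where M: "M \<subseteq> coind"
    "boundary_action (\<Gamma>\<lparr>carrier := \<Lambda>\<rparr>) (subtopology coind_topology M) (\<lambda>l. restrict (translate l) M)"
    by (rule coind_boundary_exists)
  obtain f where f: "continuous_map X (subtopology coind_topology M) f"
    and fe: "\<And>l x. l \<in> \<Lambda> \<Longrightarrow> x \<in> topspace X \<Longrightarrow> f (\<phi> l x) = restrict (translate l) M (f x)"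
    using furstenberg_boundary_universal[OF assms(4) M(2)] by auto
  have fM: "f x \<in> M" if "x \<in> topspace X" for x
    using continuous_map_image_subset_topspace[OF f] that by auto
  then have fY: "f x \<in> coind" if "x \<in> topspace X" for x
    using that M(1) by blast
  define \<psi> where "\<psi> g x = f x g" for g x
  have cont: "continuous_map X X (\<psi> g)" if g: "g \<in> carrier \<Gamma>" for g
  proof -
    have "continuous_map X (product_topology (\<lambda>_. X) (carrier \<Gamma>)) f"
      using f by (simp add: continuous_map_in_subtopology)
    from continuous_map_compose[OF this continuous_eval[OF g]] show ?thesis
      by (simp add: \<psi>_def[abs_def] o_def)
  qed
  have \<psi>X: "\<psi> g x \<in> topspace X" if "g \<in> carrier \<Gamma>" "x \<in> topspace X" for g x
    using coind_value[OF fY] that by (simp add: \<psi>_def)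
  \<comment> \<open>Left equivariance holds because the values of \<open>f\<close> are in
    \<open>coind\<close>, right equivariance because \<open>f\<close> intertwines
    \<open>\<phi>\<close> with translation. Combined, they give equivariance through conjugation by
    \<open>g\<close>.\<close>
  have left: "\<psi> (l \<otimes>\<^bsub>\<Gamma>\<^esub> g) x = \<phi> l (\<psi> g x)" if "l \<in> \<Lambda>" "g \<in> carrier \<Gamma>" "x \<in> topspace X" for l g x
    using coind_equivariant[OF fY] that by (simp add: \<psi>_def)
  have right: "\<psi> g (\<phi> l x) = \<psi> (g \<otimes>\<^bsub>\<Gamma>\<^esub> l) x" if "l \<in> \<Lambda>" "g \<in> carrier \<Gamma>" "x \<in> topspace X" for l g x
    using fe[OF that(1,3)] fM[OF that(3)] that(2) by (simp add: \<psi>_def translate_apply)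
  have equi: "\<psi> g (\<phi> n x) = \<phi> (g \<otimes>\<^bsub>\<Gamma>\<^esub> n \<otimes>\<^bsub>\<Gamma>\<^esub> inv\<^bsub>\<Gamma>\<^esub> g) (\<psi> g x)"
    if n: "n \<in> core S" and g: "g \<in> S" "g \<in> carrier \<Gamma>" and x: "x \<in> topspace X" for n g x S
  proof -
    have nc: "n \<in> \<Lambda>" "n \<in> carrier \<Gamma>" using n core_L L_carrier by auto
    then have "g \<otimes>\<^bsub>\<Gamma>\<^esub> n = (g \<otimes>\<^bsub>\<Gamma>\<^esub> n \<otimes>\<^bsub>\<Gamma>\<^esub> inv\<^bsub>\<Gamma>\<^esub> g) \<otimes>\<^bsub>\<Gamma>\<^esub> g" using g(2) by (simp add: m_assoc)
    then show ?thesis using right[OF nc(1) g(2) x] left[OF core_conj[OF n g(1)] g(2) x] by simp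
  qed
  \<comment> \<open>Conjugation by the unit is trivial, so the identity map has the same
    equivariance as \<open>\<psi>\<close> at the unit.\<close>
  have one: "\<psi> \<one>\<^bsub>\<Gamma>\<^esub> x = x" if x: "x \<in> topspace X" for x
  proof (rule equivariant_maps_unique[of "{\<one>\<^bsub>\<Gamma>\<^esub>}" "\<one>\<^bsub>\<Gamma>\<^esub>" "\<psi> \<one>\<^bsub>\<Gamma>\<^esub>" "\<lambda>x. x"])
    show "\<psi> \<one>\<^bsub>\<Gamma>\<^esub> (\<phi> n y) = \<phi> (\<one>\<^bsub>\<Gamma>\<^esub> \<otimes>\<^bsub>\<Gamma>\<^esub> n \<otimes>\<^bsub>\<Gamma>\<^esub> inv\<^bsub>\<Gamma>\<^esub> \<one>\<^bsub>\<Gamma>\<^esub>) (\<psi> \<one>\<^bsub>\<Gamma>\<^esub> y)"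
      if "n \<in> core {\<one>\<^bsub>\<Gamma>\<^esub>}" "y \<in> topspace X" for n y
      using that by (intro equi) auto
  qed (use x cont core_L L_carrier in auto)
  have act: "\<psi> l x = \<phi> l x" if "l \<in> \<Lambda>" "x \<in> topspace X" for l x
    using left[OF that(1) one_closed that(2)] one that L_carrier by simp
  have mult: "\<psi> (g \<otimes>\<^bsub>\<Gamma>\<^esub> h) x = \<psi> g (\<psi> h x)"
    if g: "g \<in> carrier \<Gamma>" and h: "h \<in> carrier \<Gamma>" and x: "x \<in> topspace X" for g h x
  proof (rule equivariant_maps_unique[of "{g \<otimes>\<^bsub>\<Gamma>\<^esub> h, h}" "g \<otimes>\<^bsub>\<Gamma>\<^esub> h"
        "\<psi> (g \<otimes>\<^bsub>\<Gamma>\<^esub> h)" "\<lambda>x. \<psi> g (\<psi> h x)"])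
    let ?S = "{g \<otimes>\<^bsub>\<Gamma>\<^esub> h, h}"
    show "continuous_map X X (\<lambda>x. \<psi> g (\<psi> h x))"
      using continuous_map_compose[OF cont[OF h] cont[OF g]] by (simp add: o_def)
    fix n y assume n: "n \<in> core ?S" and y: "y \<in> topspace X"
    show "\<psi> (g \<otimes>\<^bsub>\<Gamma>\<^esub> h) (\<phi> n y) = \<phi> (g \<otimes>\<^bsub>\<Gamma>\<^esub> h \<otimes>\<^bsub>\<Gamma>\<^esub> n \<otimes>\<^bsub>\<Gamma>\<^esub> inv\<^bsub>\<Gamma>\<^esub> (g \<otimes>\<^bsub>\<Gamma>\<^esub> h)) (\<psi> (g \<otimes>\<^bsub>\<Gamma>\<^esub> h) y)"
      using g h y by (intro equi[OF n]) auto
    let ?n = "h \<otimes>\<^bsub>\<Gamma>\<^esub> n \<otimes>\<^bsub>\<Gamma>\<^esub> inv\<^bsub>\<Gamma>\<^esub> h"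
    have nc: "n \<in> carrier \<Gamma>" using n core_L L_carrier by blast
    have gn: "g \<otimes>\<^bsub>\<Gamma>\<^esub> ?n \<otimes>\<^bsub>\<Gamma>\<^esub> inv\<^bsub>\<Gamma>\<^esub> g = g \<otimes>\<^bsub>\<Gamma>\<^esub> h \<otimes>\<^bsub>\<Gamma>\<^esub> n \<otimes>\<^bsub>\<Gamma>\<^esub> inv\<^bsub>\<Gamma>\<^esub> (g \<otimes>\<^bsub>\<Gamma>\<^esub> h)"
      using g h nc by (simp add: m_assoc inv_mult_group)
    have "?n \<in> core {g}"
      using core_conj[OF n, of h] core_conj[OF n, of "g \<otimes>\<^bsub>\<Gamma>\<^esub> h"] gn by (simp add: core_def)
    then have "\<psi> g (\<phi> ?n (\<psi> h y)) = \<phi> (g \<otimes>\<^bsub>\<Gamma>\<^esub> ?n \<otimes>\<^bsub>\<Gamma>\<^esub> inv\<^bsub>\<Gamma>\<^esub> g) (\<psi> g (\<psi> h y))"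
      using g \<psi>X[OF h y] by (intro equi[of _ "{g}"]) auto
    moreover have "\<psi> h (\<phi> n y) = \<phi> ?n (\<psi> h y)"
      using h y by (intro equi[OF n]) auto
    ultimately show "\<psi> g (\<psi> h (\<phi> n y)) = \<phi> (g \<otimes>\<^bsub>\<Gamma>\<^esub> h \<otimes>\<^bsub>\<Gamma>\<^esub> n \<otimes>\<^bsub>\<Gamma>\<^esub> inv\<^bsub>\<Gamma>\<^esub> (g \<otimes>\<^bsub>\<Gamma>\<^esub> h)) (\<psi> g (\<psi> h y))"
      by (simp add: gn)
  qed (use g h x cont in auto)
  have ho\<psi>: "homeo_action \<Gamma> X (\<lambda>g. restrict (\<psi> g) (topspace X))"
    using cont mult one by (intro homeo_actionI[OF assms(1)])
  \<comment> \<open>For any extension the action law and agreement with \<open>\<phi>\<close> on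
    \<Lambda> already give equivariance of \<open>\<psi>' g\<close> for conjugation by
    \<open>g\<close> on \<open>core {g}\<close>.\<close>
  have unique: "\<psi>' g x = \<psi> g x"
    if \<psi>': "homeo_action \<Gamma> X \<psi>'" "\<forall>l\<in>\<Lambda>. \<forall>x\<in>topspace X. \<psi>' l x = \<phi> l x"
      and g: "g \<in> carrier \<Gamma>" and x: "x \<in> topspace X" for \<psi>' g x
  proof (rule equivariant_maps_unique[of "{g}" g "\<psi>' g" "\<psi> g"])
    show "continuous_map X X (\<psi>' g)" using homeo_action_continuous[OF \<psi>'(1) g] .
    fix n y assume n: "n \<in> core {g}" and y: "y \<in> topspace X"
    show "\<psi> g (\<phi> n y) = \<phi> (g \<otimes>\<^bsub>\<Gamma>\<^esub> n \<otimes>\<^bsub>\<Gamma>\<^esub> inv\<^bsub>\<Gamma>\<^esub> g) (\<psi> g y)"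
      using g y by (intro equi[OF n]) auto
    let ?n = "g \<otimes>\<^bsub>\<Gamma>\<^esub> n \<otimes>\<^bsub>\<Gamma>\<^esub> inv\<^bsub>\<Gamma>\<^esub> g"
    have nc: "n \<in> \<Lambda>" "n \<in> carrier \<Gamma>" using n core_L L_carrier by auto
    have nL: "?n \<in> \<Lambda>" using core_conj[OF n] by simp
    have "\<psi>' g (\<phi> n y) = \<psi>' (g \<otimes>\<^bsub>\<Gamma>\<^esub> n) y"
      using \<psi>'(2) nc y homeo_action_mult[OF \<psi>'(1) g nc(2) y] by simp
    also have "g \<otimes>\<^bsub>\<Gamma>\<^esub> n = ?n \<otimes>\<^bsub>\<Gamma>\<^esub> g" using g nc by (simp add: m_assoc)
    also have "\<psi>' (?n \<otimes>\<^bsub>\<Gamma>\<^esub> g) y = \<phi> ?n (\<psi>' g y)"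
      using \<psi>'(2) nL homeo_action_mult[OF \<psi>'(1) L_carrier[OF nL] g y] homeo_action_closed[OF \<psi>'(1) g y]
      by simp
    finally show "\<psi>' g (\<phi> n y) = \<phi> ?n (\<psi>' g y)" .
  qed (use g x cont in auto)
  show ?thesis
  proof (intro exI[of _ "\<lambda>g. restrict (\<psi> g) (topspace X)"] conjI allI ballI impI)
    show "homeo_action \<Gamma> X (\<lambda>g. restrict (\<psi> g) (topspace X))" by (rule ho\<psi>)
    show "restrict (\<psi> l) (topspace X) x = \<phi> l x" if "l \<in> \<Lambda>" "x \<in> topspace X" for l x
      using act that by simp
    fix \<psi>' g x
    assume "homeo_action \<Gamma> X \<psi>' \<and> (\<forall>l\<in>\<Lambda>. \<forall>x\<in>topspace X. \<psi>' l x = \<phi> l x)"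
      and g: "g \<in> carrier \<Gamma>" and x: "x \<in> topspace X"
    then have "\<psi>' g x = \<psi> g x" using unique[of \<psi>' g x] by simp
    with x show "\<psi>' g x = restrict (\<psi> g) (topspace X) x" by simp
  qed
qed

end
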